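(* Let $n\ge3$ be odd and let $\kappa,\mathbf{c}_0,\mathbf{c}_1\in k$ with $\mathbf{c}_0\ne0$. Put $$g_1=-\frac{\sigma}{4\mathbf{c}_0},\qquad g_2=\frac{\kappa\sigma}{4\mathbf{c}_0}-\frac1{2n},\qquad g_3=\frac14(1-\xi_1)(1-\xi_2),\qquad g_4=-\frac{\mathbf{c}_1}{4\mathbf{c}_0}(\xi_1-\xi_2)\sigma .$$ Identify $k^n\otimes k^n$ with the space $TruncPol_n(k[x_1,x_2])$ of polynomials spanned by $x_1^jx_2^\ell$, $0\le j,\ell<n$, via $e_j\otimes e_\ell\leftrightarrow x_1^{j-1}x_2^{\ell-1}$. Under this identification the Cremmer-Gervais $r$-matrix $r_{n-2,n}$ acts as the element $$r_{n-2,n}=g_1(x_1y_1-x_2y_2)+g_2(x_1\partial_1-x_2\partial_2)+\left(\frac{x_2}{x_1}-\frac{x_1}{x_2}\right)g_3+g_4$$ of the algebra $\widetilde H$ of differential-Dunkl operators.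
   Context: $k$ is an algebraically closed field of characteristic zero. Operators on $k[x_1^{\pm1},x_2^{\pm1}]$: $x_i^{\pm1}$ acts by multiplication, $\partial_i=\partial/\partial x_i$, $(\sigma f)(x_1,x_2)=f(x_2,x_1)$, $(\xi_1f)(x_1,x_2)=f(-x_1,x_2)$, $(\xi_2f)(x_1,x_2)=f(x_1,-x_2)$, and the Dunkl operators are $$y_1f=\kappa\partial_1f-\mathbf{c}_0\frac{f-\sigma f}{x_1-x_2}-\mathbf{c}_0\frac{f-\xi_1\xi_2\sigma f}{x_1+x_2}-\mathbf{c}_1\frac{f-\xi_1f}{x_1},$$ $$y_2f=\kappa\partial_2f+\mathbf{c}_0\frac{f-\sigma f}{x_1-x_2}-\mathbf{c}_0\frac{f-\xi_1\xi_2\sigma f}{x_1+x_2}-\mathbf{c}_1\frac{f-\xi_2f}{x_2}.$$ These are the operators of the polynomial representation of the rational Cherednik algebra $H=H_{\kappa,\mathbf c}(G(2,1,2))$, generated by $\sigma,\xi_i,x_i,y_i$ ($i=1,2$); $\widetilde H=H\langle x_1^{-1},x_2^{-1},\partial_1,\partial_2\rangle$ is obtained by adjoining $x_i^{-1}$ and $\partial_i$. Elementary matrices $e_{ij}$ act on $k^n$ by $e_{ij}e_\ell=\delta_{j\ell}e_i$, and $a\wedge b:=\frac12(a\otimes b-b\otimes a)$; residues mod $p$ are taken in $\{0,\dots,p-1\}$. Definition of $r_{q,n}\in\mathfrak{sl}_n\wedge\mathfrak{sl}_n$ for coprime $1\le q<n$ (used with $q=n-2$): let $\Pi=\{\alpha_1,\dots,\alpha_{n-1}\}$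 be the simple roots of $\mathfrak{sl}_n$. For $a<b$, $e_{ab}=e_\rho$ is the root vector of $\rho=\alpha_a+\cdots+\alpha_{b-1}$, and $e_{-\rho}=e_{ba}$. Let $\mathcal S_0=\Pi\setminus\{\alpha_{n-q}\}$, $\zeta:\mathcal S_0\to\Pi\setminus\{\alpha_q\}$, $\zeta(\alpha_s)=\alpha_{(s+q)\bmod n}$, and let $\widehat\zeta$ be its additive extension to positive roots that are sums of elements of $\mathcal S_0$. Write $\rho\prec\mu$ if for some integer $N\ge1$, $\widehat\zeta^{\,N}(\rho)$ is defined and equals $\mu$. Then $$r_{q,n}=2\sum_{\rho\prec\mu}e_\rho\wedge e_{-\mu}+\sum_{1\le j<\ell\le n}\Big(-1+\tfrac2n\big[(j-\ell)q^{-1}\bmod n\big]\Big)e_{jj}\wedge e_{\ell\ell}+\sum_{1\le j<\ell\le n}e_{j\ell}\wedge e_{\ell j},$$ with $q^{-1}$ an inverse of $q$ modulo $n$. *)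

theory Defs
  imports
    "HOL-Computational_Algebra.Polynomial"
    "HOL-Library.Poly_Mapping"
    "HOL-Library.Product_Plus"
    "HOL-Number_Theory.Modular_Inverse"
begin

section \<open>Free modules\<close>

text \<open>The free module on a set of basis symbols of type \<open>'a\<close> is \<open>'a \<Rightarrow>\<^sub>0 'k\<close>.\<close>

definition scl :: "'k \<Rightarrow> ('a \<Rightarrow>\<^sub>0 'k) \<Rightarrow> ('a \<Rightarrow>\<^sub>0 'k::comm_ring_1)" where
  "scl c f = Poly_Mapping.map ((*) c) f"

definition lin_ext :: "('a \<Rightarrow> ('b \<Rightarrow>\<^sub>0 'k)) \<Rightarrow> ('a \<Rightarrow>\<^sub>0 'k) \<Rightarrow> ('b \<Rightarrow>\<^sub>0 'k::comm_ring_1)" where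
  "lin_ext \<phi> f = (\<Sum>a\<in>Poly_Mapping.keys f. scl (Poly_Mapping.lookup f a) (\<phi> a))"

definition tensor :: "('a \<Rightarrow>\<^sub>0 'k) \<Rightarrow> ('b \<Rightarrow>\<^sub>0 'k) \<Rightarrow> (('a \<times> 'b) \<Rightarrow>\<^sub>0 'k::comm_ring_1)" where
  "tensor u v = lin_ext (\<lambda>a. lin_ext (\<lambda>b. Poly_Mapping.single (a, b) 1) v) u"

definition wedge :: "('a \<Rightarrow>\<^sub>0 'k) \<Rightarrow> ('a \<Rightarrow>\<^sub>0 'k) \<Rightarrow> (('a \<times> 'a) \<Rightarrow>\<^sub>0 'k::field)" where
  "wedge a b = scl (1/2) (tensor a b - tensor b a)"

lemma lookup_scl [simp]: "Poly_Mapping.lookup (scl c f) a = c * Poly_Mapping.lookup f a"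
  by (simp add: scl_def Poly_Mapping.map.rep_eq when_def)

lemma scl_zero [simp]: "scl 0 f = 0" "scl c 0 = 0"
  by (auto intro!: poly_mapping_eqI)

lemma scl_add: "scl c (f + g) = scl c f + scl c g" "scl (c + d) f = scl c f + scl d f"
  by (auto intro!: poly_mapping_eqI simp: lookup_add algebra_simps)

lemma scl_one [simp]: "scl 1 f = f"
  by (auto intro!: poly_mapping_eqI)

lemma poly_mapping_induct_add [case_names zero single add]:
  assumes "P 0" "\<And>a c. P (Poly_Mapping.single a c)" "\<And>f g. P f \<Longrightarrow> P g \<Longrightarrow> P (f + g)"
  shows "P (f :: 'a \<Rightarrow>\<^sub>0 'k::comm_ring_1)"
proof -
  have "P (\<Sum>a\<in>A. Poly_Mapping.single a (Poly_Mapping.lookup f a))" if "finite A" for A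
    using that by induction (auto intro: assms)
  moreover have "(\<Sum>a\<in>Poly_Mapping.keys f. Poly_Mapping.single a (Poly_Mapping.lookup f a)) = f"
    by (rule poly_mapping_eqI) (simp add: lookup_sum lookup_single when_def in_keys_iff)
  ultimately show ?thesis
    by (metis finite_keys)
qed

lemma lin_ext_superset:
  assumes "finite A" "Poly_Mapping.keys f \<subseteq> A"
  shows "lin_ext \<phi> f = (\<Sum>a\<in>A. scl (Poly_Mapping.lookup f a) (\<phi> a))"
  unfolding lin_ext_def
  by (rule sum.mono_neutral_left) (use assms in \<open>auto simp: in_keys_iff\<close>)

lemma lin_ext_zero [simp]: "lin_ext \<phi> 0 = 0"
  by (simp add: lin_ext_def)

lemma lin_ext_single [simp]: "lin_ext \<phi> (Poly_Mapping.single a c) = scl c (\<phi> a)"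
  by (simp add: lin_ext_def)

lemma lin_ext_add: "lin_ext \<phi> (f + g) = lin_ext \<phi> f + lin_ext \<phi> g"
proof -
  let ?A = "Poly_Mapping.keys f \<union> Poly_Mapping.keys g"
  have "lin_ext \<phi> (f + g) = (\<Sum>a\<in>?A. scl (Poly_Mapping.lookup (f + g) a) (\<phi> a))"
    using Poly_Mapping.keys_add[of f g] by (intro lin_ext_superset) auto
  also have "\<dots> = (\<Sum>a\<in>?A. scl (Poly_Mapping.lookup f a) (\<phi> a)) + (\<Sum>a\<in>?A. scl (Poly_Mapping.lookup g a) (\<phi> a))"
    by (simp add: lookup_add scl_add sum.distrib)
  also have "\<dots> = lin_ext \<phi> f + lin_ext \<phi> g"
    by (simp add: lin_ext_superset[of ?A])
  finally show ?thesis .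
qed


section \<open>Laurent polynomials in two variables and operators on them\<close>

text \<open>The basis symbol \<open>(a, b)\<close> is the monomial $x_1^a x_2^b$; multiplication is the
  convolution product of finitely supported functions on the additive group of exponents.\<close>

type_synonym 'k laurent = "(int \<times> int) \<Rightarrow>\<^sub>0 'k"

definition mon :: "int \<Rightarrow> int \<Rightarrow> 'k::comm_ring_1 laurent" where
  "mon a b = Poly_Mapping.single (a, b) 1"

definition mul1 :: "'k::comm_ring_1 laurent \<Rightarrow> 'k laurent" where "mul1 f = mon 1 0 * f"
definition mul2 :: "'k::comm_ring_1 laurent \<Rightarrow> 'k laurent" where "mul2 f = mon 0 1 * f"
definition mulinv1 :: "'k::comm_ring_1 laurent \<Rightarrow> 'k laurent" where "mulinv1 f = mon (-1) 0 * f"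
definition mulinv2 :: "'k::comm_ring_1 laurent \<Rightarrow> 'k laurent" where "mulinv2 f = mon 0 (-1) * f"

definition sigma :: "'k::field laurent \<Rightarrow> 'k laurent" where
  "sigma = lin_ext (\<lambda>(a, b). mon b a)"

definition xi1 :: "'k::field laurent \<Rightarrow> 'k laurent" where
  "xi1 = lin_ext (\<lambda>(a, b). scl ((-1) powi a) (mon a b))"

definition xi2 :: "'k::field laurent \<Rightarrow> 'k laurent" where
  "xi2 = lin_ext (\<lambda>(a, b). scl ((-1) powi b) (mon a b))"

definition partial1 :: "'k::field laurent \<Rightarrow> 'k laurent" where
  "partial1 = lin_ext (\<lambda>(a, b). scl (of_int a) (mon (a - 1) b))"

definition partial2 :: "'k::field laurent \<Rightarrow> 'k laurent" where
  "partial2 = lin_ext (\<lambda>(a, b). scl (of_int b) (mon a (b - 1)))"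

text \<open>Exact division. Only meaningful when the quotient exists and is unique, which is the case for
  all the quotients in the Dunkl operators; see \<open>dunkl_quotients\<close> below.\<close>

definition quot :: "'k::field laurent \<Rightarrow> 'k laurent \<Rightarrow> 'k laurent" where
  "quot f g = (THE h. g * h = f)"

definition dunkl1 :: "'k::field \<Rightarrow> 'k \<Rightarrow> 'k \<Rightarrow> 'k laurent \<Rightarrow> 'k laurent" where
  "dunkl1 \<kappa> c0 c1 f =
     scl \<kappa> (partial1 f)
     - scl c0 (quot (f - sigma f) (mon 1 0 - mon 0 1))
     - scl c0 (quot (f - xi1 (xi2 (sigma f))) (mon 1 0 + mon 0 1))
     - scl c1 (quot (f - xi1 f) (mon 1 0))"

definition dunkl2 :: "'k::field \<Rightarrow> 'k \<Rightarrow> 'k \<Rightarrow> 'k laurent \<Rightarrow> 'k laurent" where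
  "dunkl2 \<kappa> c0 c1 f =
     scl \<kappa> (partial2 f)
     + scl c0 (quot (f - sigma f) (mon 1 0 - mon 0 1))
     - scl c0 (quot (f - xi1 (xi2 (sigma f))) (mon 1 0 + mon 0 1))
     - scl c1 (quot (f - xi2 f) (mon 0 1))"

lemma mon_mult: "mon a b * mon c d = mon (a + c) (b + d)"
  by (simp add: mon_def mult_single)

lemma lookup_single_mult:
  fixes h :: "'k::comm_ring_1 laurent"
  shows "Poly_Mapping.lookup (Poly_Mapping.single m c * h) k = c * Poly_Mapping.lookup h (k - m)"
proof (induction h rule: poly_mapping_induct_add)
  case (single l v)
  have "(k = m + l) = (k - m = l)" by (auto simp: algebra_simps)
  then show ?case by (auto simp: mult_single lookup_single when_def)
qed (simp_all add: distrib_left lookup_add)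

lemma single_eq_scl_mon: "Poly_Mapping.single (a, b) c = scl c (mon a b)"
  by (rule poly_mapping_eqI) (simp add: mon_def lookup_single when_def)

lemma scl_mult: "scl c f * g = scl c (f * g)" "f * scl c g = scl c (f * g)"
  for f g :: "'k::comm_ring_1 laurent"
proof -
  have *: "scl c h = Poly_Mapping.single (0, 0) c * h" for h :: "'k laurent"
    by (rule poly_mapping_eqI) (simp add: lookup_single_mult flip: zero_prod_def)
  show "scl c f * g = scl c (f * g)" "f * scl c g = scl c (f * g)"
    by (simp_all add: * mult_ac)
qed

lemma binomial_cancel:
  fixes h :: "'k::field laurent"
  assumes "(mon 1 0 + scl s (mon 0 1)) * h = 0"
  shows "h = 0"
proof (rule ccontr)
  assume "h \<noteq> 0"
  define m where "m = Max (fst ` Poly_Mapping.keys h)"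
  have "m \<in> fst ` Poly_Mapping.keys h"
    unfolding m_def using \<open>h \<noteq> 0\<close> by (intro Max_in) auto
  then obtain b where b: "(m, b) \<in> Poly_Mapping.keys h" by auto
  have "(m + 1, b - 1) \<notin> Poly_Mapping.keys h"
  proof
    assume "(m + 1, b - 1) \<in> Poly_Mapping.keys h"
    then have "m + 1 \<le> m" unfolding m_def by (intro Max_ge) (auto simp: image_iff intro: bexI[rotated])
    then show False by simp
  qed
  then have z: "Poly_Mapping.lookup h (m + 1, b - 1) = 0" by (simp add: in_keys_iff)
  have "0 = Poly_Mapping.lookup ((mon 1 0 + scl s (mon 0 1)) * h) (m + 1, b)"
    using assms by simp
  also have "\<dots> = Poly_Mapping.lookup h (m, b)"
    using z by (simp add: distrib_right lookup_add scl_mult mon_def lookup_single_mult)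
  finally show False using b by (simp add: in_keys_iff)
qed

lemma binomial_dvd_power:
  fixes s :: "'k::field"
  shows "(mon 1 0 + scl s (mon 0 1)) dvd (mon (a + int n) b - scl ((-s) ^ n) (mon a (b + int n)))"
proof (induction n arbitrary: b)
  case (Suc n)
  let ?g = "mon 1 0 + scl s (mon 0 1)"
  have "?g dvd ?g * mon (a + int n) b" by simp
  also have "?g * mon (a + int n) b
      = mon (a + int (Suc n)) b - scl (-s) (mon (a + int n) (b + 1))"
    by (rule poly_mapping_eqI)
       (simp add: distrib_right scl_mult mon_mult algebra_simps lookup_add lookup_minus)
  finally have 1: "?g dvd mon (a + int (Suc n)) b - scl (-s) (mon (a + int n) (b + 1))" .
  have "?g dvd scl (-s) 1 * (mon (a + int n) (b + 1) - scl ((-s) ^ n) (mon a (b + 1 + int n)))"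
    using Suc.IH[of "b + 1"] by (rule dvd_mult)
  also have "scl (-s) 1 * (mon (a + int n) (b + 1) - scl ((-s) ^ n) (mon a (b + 1 + int n)))
      = scl (-s) (mon (a + int n) (b + 1)) - scl ((-s) ^ Suc n) (mon a (b + int (Suc n)))"
    by (rule poly_mapping_eqI) (simp add: scl_mult lookup_minus algebra_simps)
  finally have 2: "?g dvd \<dots>" .
  from dvd_add[OF 1 2] show ?case by (simp add: algebra_simps)
qed (simp add: mon_def)

lemma binomial_dvd_mon:
  fixes s :: "'k::field"
  assumes "s = 1 \<or> s = -1"
  shows "(mon 1 0 + scl s (mon 0 1)) dvd (mon a b - scl ((-s) powi (a + b)) (mon b a))"
proof -
  have per: "(-s) powi (a + b) = (-s) ^ nat \<bar>a - b\<bar>"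
  proof -
    have "(-1 :: 'k) powi (a + b) = (-1) ^ nat \<bar>a - b\<bar>"
      by (auto simp: power_int_minus_left_distrib power_int_minus_one_minus uminus_power_if
                     power_int_minus_left even_nat_iff)
    then show ?thesis using assms by auto
  qed
  show ?thesis
  proof (cases "b \<le> a")
    case True
    then show ?thesis using binomial_dvd_power[of s b "nat (a - b)" b] by (simp add: per)
  next
    case False
    then have "(mon 1 0 + scl s (mon 0 1)) dvd (mon b a - scl ((-s) ^ nat (b - a)) (mon a b))"
      using binomial_dvd_power[of s a "nat (b - a)" a] by simp
    then have "(mon 1 0 + scl s (mon 0 1))
        dvd scl (- ((-s) ^ nat (b - a))) 1 * (mon b a - scl ((-s) ^ nat (b - a)) (mon a b))"
      by (rule dvd_mult)
    also have "scl (- ((-s) ^ nat (b - a))) 1 * (mon b a - scl ((-s) ^ nat (b - a)) (mon a b))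
        = mon a b - scl ((-s) ^ nat (b - a)) (mon b a)"
    proof -
      have "(-s) ^ nat (b - a) * ((-s) ^ nat (b - a)) = 1"
        using assms by (auto simp flip: power_mult_distrib)
      then show ?thesis
        by (intro poly_mapping_eqI) (simp add: scl_mult lookup_minus algebra_simps flip: mult.assoc)
    qed
    finally show ?thesis using False by (simp add: per)
  qed
qed

lemma dvd_lin_ext:
  fixes f g :: "'k::field laurent"
  assumes "\<And>a b. g dvd mon a b - \<phi> (a, b)"
  shows "g dvd f - lin_ext \<phi> f"
proof (induction f rule: poly_mapping_induct_add)
  case (single m c)
  obtain a b where m: "m = (a, b)" by force
  have "g dvd scl c 1 * (mon a b - \<phi> (a, b))" using assms by (rule dvd_mult)
  also have "\<dots> = Poly_Mapping.single m c - lin_ext \<phi> (Poly_Mapping.single m c)"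
    by (rule poly_mapping_eqI) (simp add: m single_eq_scl_mon scl_mult right_diff_distrib lookup_minus lin_ext_single[of \<phi> "(a,b)", unfolded single_eq_scl_mon])
  finally show ?case .
next
  case (add f1 f2)
  have "f1 + f2 - lin_ext \<phi> (f1 + f2) = (f1 - lin_ext \<phi> f1) + (f2 - lin_ext \<phi> f2)"
    by (simp add: lin_ext_add)
  then show ?case using add by (metis dvd_add)
qed simp

lemma xi1_xi2_sigma:
  "xi1 (xi2 (sigma f)) = lin_ext (\<lambda>(a, b). scl ((-1) powi (a + b)) (mon b a)) f"
proof (induction f rule: poly_mapping_induct_add)
  case (single m c)
  obtain a b where m: "m = (a, b)" by force
  have l: "lin_ext \<phi> (scl d (mon p q)) = scl d (\<phi> (p, q))"
    for \<phi> and d :: 'a and p q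
    using lin_ext_single[of \<phi> "(p,q)" d] by (simp add: single_eq_scl_mon)
  have s: "scl d (scl e h) = scl (d * e) h" for d e and h :: "'a laurent"
    by (rule poly_mapping_eqI) (simp add: mult_ac)
  show ?case
    by (simp add: m single_eq_scl_mon xi1_def xi2_def sigma_def l s power_int_add mult_ac)
qed (simp_all add: xi1_def xi2_def sigma_def lin_ext_add)

lemma dunkl_quotients:
  fixes f :: "'k::field laurent"
  shows "\<exists>!h. (mon 1 0 - mon 0 1) * h = f - sigma f"
    and "\<exists>!h. (mon 1 0 + mon 0 1) * h = f - xi1 (xi2 (sigma f))"
    and "\<exists>!h. mon 1 0 * h = f - xi1 f"
    and "\<exists>!h. mon 0 1 * h = f - xi2 f"
proof -
  have u: "\<exists>!h. g * h = f'" if d: "g dvd f'" and "\<And>h. g * h = 0 \<Longrightarrow> h = 0" for g f' :: "'k laurent"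
  proof -
    obtain h where h: "g * h = f'" using d unfolding dvd_def by blast
    moreover have "h' = h" if "g * h' = f'" for h'
      using \<open>\<And>h. g * h = 0 \<Longrightarrow> h = 0\<close>[of "h' - h"] h that by (simp add: right_diff_distrib)
    ultimately show ?thesis by blast
  qed
  have m: "mon 1 0 + scl (-1) (mon 0 1) = (mon 1 0 - mon 0 1 :: 'k laurent)"
    by (rule poly_mapping_eqI) (simp add: lookup_add lookup_minus)
  show "\<exists>!h. (mon 1 0 - mon 0 1) * h = f - sigma f"
  proof (rule u)
    show "mon 1 0 - mon 0 1 dvd f - sigma f"
      unfolding sigma_def using binomial_dvd_mon[of "-1 :: 'k", unfolded m]
      by (intro dvd_lin_ext) simp
  qed (use binomial_cancel[of "-1 :: 'k", unfolded m] in auto)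
  show "\<exists>!h. (mon 1 0 + mon 0 1) * h = f - xi1 (xi2 (sigma f))"
  proof (rule u)
    show "mon 1 0 + mon 0 1 dvd f - xi1 (xi2 (sigma f))"
      unfolding xi1_xi2_sigma using binomial_dvd_mon[of "1 :: 'k"]
      by (intro dvd_lin_ext) simp
  qed (use binomial_cancel[of "1 :: 'k"] in auto)
  have unit: "\<exists>!h. g * h = f'" if i: "g * g' = 1" for g g' f' :: "'k laurent"
  proof (rule u)
    have "f' = g * (g' * f')" using i by (simp flip: mult.assoc)
    then show "g dvd f'" by (rule dvdI)
    show "h = 0" if z: "g * h = 0" for h
    proof -
      have "h = (g * g') * h" using i by simp
      also have "\<dots> = g' * (g * h)" by (simp only: mult_ac)
      finally show ?thesis using z by simp
    qed
  qed
  have "mon 0 0 = (1 :: 'k laurent)"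
    unfolding mon_def single_one[symmetric] zero_prod_def ..
  then have "mon 1 0 * mon (-1) 0 = (1 :: 'k laurent)" "mon 0 1 * mon 0 (-1) = (1 :: 'k laurent)"
    by (simp_all add: mon_mult)
  then show "\<exists>!h. mon 1 0 * h = f - xi1 f" "\<exists>!h. mon 0 1 * h = f - xi2 f"
    by - (rule unit, assumption)+
qed


section \<open>The algebra of differential-Dunkl operators\<close>

text \<open>The unital algebra of operators generated by \<open>S\<close>; the product is composition.\<close>

inductive_set op_algebra ::
  "('k::field laurent \<Rightarrow> 'k laurent) set \<Rightarrow> ('k laurent \<Rightarrow> 'k laurent) set" for S where
  gen: "A \<in> S \<Longrightarrow> A \<in> op_algebra S"
| one: "(\<lambda>f. f) \<in> op_algebra S"
| add: "A \<in> op_algebra S \<Longrightarrow> B \<in> op_algebra S \<Longrightarrow> (\<lambda>f. A f + B f) \<in> op_algebra S"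
| scale: "A \<in> op_algebra S \<Longrightarrow> (\<lambda>f. scl c (A f)) \<in> op_algebra S"
| mult: "A \<in> op_algebra S \<Longrightarrow> B \<in> op_algebra S \<Longrightarrow> (\<lambda>f. A (B f)) \<in> op_algebra S"

text \<open>The algebra $H$ and its enlargement $\widetilde H$, both as algebras of operators on
  Laurent polynomials (the polynomial representation).\<close>

definition cherednik :: "'k::field \<Rightarrow> 'k \<Rightarrow> 'k \<Rightarrow> ('k laurent \<Rightarrow> 'k laurent) set" where
  "cherednik \<kappa> c0 c1 =
     op_algebra {sigma, xi1, xi2, mul1, mul2, dunkl1 \<kappa> c0 c1, dunkl2 \<kappa> c0 c1}"

definition diff_dunkl :: "'k::field \<Rightarrow> 'k \<Rightarrow> 'k \<Rightarrow> ('k laurent \<Rightarrow> 'k laurent) set" where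
  "diff_dunkl \<kappa> c0 c1 =
     op_algebra (cherednik \<kappa> c0 c1 \<union> {mulinv1, mulinv2, partial1, partial2})"

definition g1 :: "'k::field \<Rightarrow> 'k laurent \<Rightarrow> 'k laurent" where
  "g1 c0 f = scl (- 1 / (4 * c0)) (sigma f)"

definition g2 :: "nat \<Rightarrow> 'k::field \<Rightarrow> 'k \<Rightarrow> 'k laurent \<Rightarrow> 'k laurent" where
  "g2 n \<kappa> c0 f = scl (\<kappa> / (4 * c0)) (sigma f) - scl (1 / (2 * of_nat n)) f"

definition g3 :: "'k::field laurent \<Rightarrow> 'k laurent" where
  "g3 f = scl (1 / 4) ((f - xi2 f) - xi1 (f - xi2 f))"

definition g4 :: "'k::field \<Rightarrow> 'k \<Rightarrow> 'k laurent \<Rightarrow> 'k laurent" where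
  "g4 c0 c1 f = scl (- c1 / (4 * c0)) (xi1 (sigma f) - xi2 (sigma f))"

definition cg_operator :: "nat \<Rightarrow> 'k::field \<Rightarrow> 'k \<Rightarrow> 'k \<Rightarrow> 'k laurent \<Rightarrow> 'k laurent" where
  "cg_operator n \<kappa> c0 c1 f =
     g1 c0 (mul1 (dunkl1 \<kappa> c0 c1 f) - mul2 (dunkl2 \<kappa> c0 c1 f))
     + g2 n \<kappa> c0 (mul1 (partial1 f) - mul2 (partial2 f))
     + (mul2 (mulinv1 (g3 f)) - mul1 (mulinv2 (g3 f)))
     + g4 c0 c1 f"


section \<open>Cremmer-Gervais r-matrices\<close>

text \<open>Elements of $k^n$, of $\mathfrak{gl}_n$ and of their tensor squares are represented in free
  modules on the symbols $e_j$, $e_{ij}$ and pairs of these, with indices in $\{1,\dots,n\}$.\<close>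

definition e_vec :: "nat \<Rightarrow> (nat \<Rightarrow>\<^sub>0 'k::comm_ring_1)" where
  "e_vec j = Poly_Mapping.single j 1"

definition e_mat :: "nat \<Rightarrow> nat \<Rightarrow> ((nat \<times> nat) \<Rightarrow>\<^sub>0 'k::comm_ring_1)" where
  "e_mat i j = Poly_Mapping.single (i, j) 1"

definition mat_act ::
  "((nat \<times> nat) \<Rightarrow>\<^sub>0 'k::comm_ring_1) \<Rightarrow> (nat \<Rightarrow>\<^sub>0 'k) \<Rightarrow> (nat \<Rightarrow>\<^sub>0 'k)" where
  "mat_act A v = lin_ext (\<lambda>(i, j). lin_ext (\<lambda>l. if j = l then e_vec i else 0) v) A"

text \<open>The bilinear extension of $(A \otimes B)(u \otimes v) = Au \otimes Bv$.\<close>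

definition tensor_act ::
  "((nat \<times> nat) \<times> (nat \<times> nat) \<Rightarrow>\<^sub>0 'k::comm_ring_1) \<Rightarrow> (nat \<times> nat \<Rightarrow>\<^sub>0 'k) \<Rightarrow> (nat \<times> nat \<Rightarrow>\<^sub>0 'k)" where
  "tensor_act R t = lin_ext (\<lambda>((i, j), (k, l)). lin_ext (\<lambda>(a, b).
     tensor (mat_act (e_mat i j) (e_vec a)) (mat_act (e_mat k l) (e_vec b))) t) R"

text \<open>Roots live in the root lattice, the free abelian group on the simple roots $\alpha_s$;
  \<open>root a b\<close> is $\alpha_a + \dots + \alpha_{b-1}$.\<close>

definition simple_root :: "nat \<Rightarrow> (nat \<Rightarrow>\<^sub>0 int)" where
  "simple_root s = Poly_Mapping.single s 1"

definition root :: "nat \<Rightarrow> nat \<Rightarrow> (nat \<Rightarrow>\<^sub>0 int)" where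
  "root a b = (\<Sum>s = a..<b. simple_root s)"

definition pos_roots :: "nat \<Rightarrow> (nat \<Rightarrow>\<^sub>0 int) set" where
  "pos_roots n = {root a b | a b. 1 \<le> a \<and> a < b \<and> b \<le> n}"

text \<open>The graph of $\widehat\zeta$: its domain consists of the positive roots that are sums of simple
  roots other than $\alpha_{n-q}$.\<close>

definition zeta_graph :: "nat \<Rightarrow> nat \<Rightarrow> ((nat \<Rightarrow>\<^sub>0 int) \<times> (nat \<Rightarrow>\<^sub>0 int)) set" where
  "zeta_graph q n = {(\<rho>, lin_ext (\<lambda>s. simple_root ((s + q) mod n)) \<rho>) | \<rho>.
     \<rho> \<in> pos_roots n \<and> Poly_Mapping.keys \<rho> \<subseteq> {1..n-1} - {n - q}}"

definition root_prec :: "nat \<Rightarrow> nat \<Rightarrow> (nat \<Rightarrow>\<^sub>0 int) \<Rightarrow> (nat \<Rightarrow>\<^sub>0 int) \<Rightarrow> bool" where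
  "root_prec q n \<rho> \<mu> \<longleftrightarrow> (\<exists>N\<ge>1. (\<rho>, \<mu>) \<in> zeta_graph q n ^^ N)"

definition index_pairs :: "nat \<Rightarrow> (nat \<times> nat) set" where
  "index_pairs n = {(j, l). 1 \<le> j \<and> j < l \<and> l \<le> n}"

text \<open>In the first sum \<open>(a, b)\<close> and \<open>(c, d)\<close> stand for \<open>\<rho> = root a b\<close> and \<open>\<mu> = root c d\<close>,
  so that $e_{-\mu} = e_{dc}$.\<close>

definition cremmer_gervais ::
  "nat \<Rightarrow> nat \<Rightarrow> ((nat \<times> nat) \<times> (nat \<times> nat) \<Rightarrow>\<^sub>0 'k::field)" where
  "cremmer_gervais q n =
     scl 2 (\<Sum>((a, b), (c, d)) \<in> {((a, b), (c, d)). (a, b) \<in> index_pairs n \<and> (c, d) \<in> index_pairs n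
               \<and> root_prec q n (root a b) (root c d)}.
              wedge (e_mat a b) (e_mat d c))
     + (\<Sum>(j, l) \<in> index_pairs n.
          scl (- 1 + 2 / of_nat n
                 * of_int (((int j - int l) * modular_inverse (int n) (int q)) mod int n))
              (wedge (e_mat j j) (e_mat l l)))
     + (\<Sum>(j, l) \<in> index_pairs n. wedge (e_mat j l) (e_mat l j))"


section \<open>Tensors as truncated polynomials\<close>

definition tensor_square :: "nat \<Rightarrow> (nat \<times> nat \<Rightarrow>\<^sub>0 'k::field) set" where
  "tensor_square n = {t. Poly_Mapping.keys t \<subseteq> {1..n} \<times> {1..n}}"

definition TruncPol :: "nat \<Rightarrow> 'k::field laurent set" where
  "TruncPol n = {\<Sum>j<n. \<Sum>l<n. scl (a j l) (mon (int j) (int l)) | a. True}"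

definition tensor_to_pol :: "(nat \<times> nat \<Rightarrow>\<^sub>0 'k) \<Rightarrow> 'k::field laurent" where
  "tensor_to_pol = lin_ext (\<lambda>(j, l). mon (int j - 1) (int l - 1))"

end

theory Submission
  imports Defs
begin

text \<open>
  Both sides are linear in the tensor, so everything is a comparison on one basis tensor
  $e_i \otimes e_j$, that is, on one monomial $f = x_1^a x_2^b$ with $a = i - 1$, $b = j - 1$.

  In $x_1 y_1 - x_2 y_2$ the part multiplied by \<open>\<kappa>\<close> is $x_1\partial_1 - x_2\partial_2$ and the part
  multiplied by \<open>c1\<close> is \<open>xi1 - xi2\<close>.  After the factor \<open>g1\<close> the first is cancelled by the \<open>\<kappa>\<close>-term of
  \<open>g2\<close> and the second by \<open>g4\<close>; the remaining \<open>c0\<close> cancels against the denominator of \<open>g1\<close>.  What is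
  left (\<open>cg_operator_without_parameters\<close>) is $-\frac1{2n}(x_1\partial_1 - x_2\partial_2)$, the term
  with \<open>g3\<close>, and
  \[ \frac14\Big(\frac{(x_1+x_2)(f-\sigma f)}{x_1-x_2}
      - \frac{(x_1-x_2)(\sigma f-\xi_1\xi_2f)}{x_1+x_2}\Big). \]
  The last expression changes sign under conjugation by \<open>sigma\<close>.  Multiplied by $x_1^2-x_2^2$ it becomes
  a Laurent polynomial with few terms, and a telescoping sum shows that for $a > b$ it consists of the
  monomials $x_1^{b+2N}x_2^{a-2N}$ with $N \ge 1$ and $b + 2N < a$, of $\frac12 \sigma f$, and of
  $\frac12 f$ if $a - b$ is even.

  On the other side, for $q = n - 2$ the map $\widehat\zeta$ lowers both indices of a root
  \<open>root a b\<close> by 2, except that it sends $\alpha_1$ to $\alpha_{n-1}$.  As $n$ is odd, this gives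
  exactly two kinds of pairs $\rho \prec \mu$ (\<open>root_prec_iff\<close>): $\rho$ is $\mu$ shifted up by $2N$, or
  both are simple, $\rho$ of odd and $\mu$ of even index.  The first kind produces the string of
  monomials above.  The second kind acts only on monomials with both exponents odd, and there by
  $x_2/x_1 - x_1/x_2$: this is the term with \<open>g3\<close>.  The last sum of the r-matrix gives
  $\pm\frac12\sigma f$.  Finally $(n-1)/2$ is the inverse of $n - 2$ modulo $n$, so the diagonal part is
  $-\frac{a-b}{2n}f$ together with $\pm\frac12 f$ when $a - b$ is even (\<open>diagonal_coefficient\<close>).
\<close>

section \<open>Linear maps of free modules\<close>

interpretation scl: module "scl :: 'k::comm_ring_1 \<Rightarrow> ('a \<Rightarrow>\<^sub>0 'k) \<Rightarrow> ('a \<Rightarrow>\<^sub>0 'k)"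
  by standard (auto intro!: poly_mapping_eqI simp: lookup_add algebra_simps)

interpretation scl_pair: module_pair "scl :: 'k::comm_ring_1 \<Rightarrow> ('a \<Rightarrow>\<^sub>0 'k) \<Rightarrow> ('a \<Rightarrow>\<^sub>0 'k)"
  "scl :: 'k \<Rightarrow> ('b \<Rightarrow>\<^sub>0 'k) \<Rightarrow> ('b \<Rightarrow>\<^sub>0 'k)" ..

abbreviation linear_map :: "(('a \<Rightarrow>\<^sub>0 'k::comm_ring_1) \<Rightarrow> ('b \<Rightarrow>\<^sub>0 'k)) \<Rightarrow> bool" where
  "linear_map \<equiv> module_hom scl scl"

lemma scl_single: "scl c (Poly_Mapping.single a d) = Poly_Mapping.single a (c * d)"
  by (rule poly_mapping_eqI) (simp add: lookup_single when_def)

lemma linear_map_lin_ext: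
  fixes \<phi> :: "'a \<Rightarrow> ('b \<Rightarrow>\<^sub>0 'k::comm_ring_1)"
  shows "linear_map (lin_ext \<phi>)"
proof unfold_locales
  fix c and f :: "'a \<Rightarrow>\<^sub>0 'k"
  show "lin_ext \<phi> (scl c f) = scl c (lin_ext \<phi> f)"
    by (induction f rule: poly_mapping_induct_add)
       (simp_all add: scl_single lin_ext_add scl.scale_right_distrib)
qed (simp add: lin_ext_add)

lemmas lin_ext_sum = linear_map_lin_ext[THEN module_hom.sum]

lemma linear_map_comp: "linear_map G \<Longrightarrow> linear_map F \<Longrightarrow> linear_map (\<lambda>f. G (F f))"
  using module_hom_compose[of scl scl F scl G] by (simp add: o_def)

lemma sum_single_keys:
  "(\<Sum>a\<in>Poly_Mapping.keys f. scl (Poly_Mapping.lookup f a) (Poly_Mapping.single a 1)) = f"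
  by (rule poly_mapping_eqI)
     (simp add: lookup_sum lookup_single when_def in_keys_iff if_distrib cong: if_cong)

lemma linear_map_eqI:
  assumes "linear_map F" "linear_map G"
    and "\<And>a. a \<in> Poly_Mapping.keys f
           \<Longrightarrow> F (Poly_Mapping.single a 1) = G (Poly_Mapping.single a 1)"
  shows "F f = G f"
proof -
  interpret F: module_hom scl scl F by fact
  interpret G: module_hom scl scl G by fact
  have "F f = F (\<Sum>a\<in>Poly_Mapping.keys f. scl (Poly_Mapping.lookup f a) (Poly_Mapping.single a 1))"
    by (simp only: sum_single_keys)
  also have "\<dots> = G (\<Sum>a\<in>Poly_Mapping.keys f. scl (Poly_Mapping.lookup f a) (Poly_Mapping.single a 1))"
    unfolding F.sum G.sum F.scale G.scale by (intro sum.cong refl) (simp add: assms(3))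
  finally show ?thesis by (simp only: sum_single_keys)
qed

lemma linear_map_mult: "linear_map (\<lambda>f. g * f :: 'k::comm_ring_1 laurent)"
  by unfold_locales (simp_all add: distrib_left scl_mult)


section \<open>Operators on Laurent polynomials\<close>

lemma lin_ext_mon [simp]: "lin_ext \<phi> (mon a b) = \<phi> (a, b)"
  by (simp add: mon_def)

text \<open>Identities between operators that are built from linear ones need only be checked on monomials;
  as an induction rule this requires no linearity proof for the composed operators.\<close>

lemma laurent_induct [case_names mon scale add]:
  assumes "\<And>a b. P (mon a b)" "\<And>c f. P f \<Longrightarrow> P (scl c f)" "\<And>f g. P f \<Longrightarrow> P g \<Longrightarrow> P (f + g)"
  shows "P (f :: 'k::comm_ring_1 laurent)"
proof (induction f rule: poly_mapping_induct_add)
  case zero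
  show ?case using assms(2)[OF assms(1), of 0] by simp
next
  case (single m c)
  show ?case using assms(2)[OF assms(1), of c "fst m" "snd m"] by (simp flip: single_eq_scl_mon)
qed (rule assms(3))

lemma operators_linear:
  "linear_map sigma" "linear_map xi1" "linear_map xi2" "linear_map partial1" "linear_map partial2"
  by (simp_all add: sigma_def xi1_def xi2_def partial1_def partial2_def linear_map_lin_ext)

lemmas operators_hom = operators_linear[THEN module_hom.add] operators_linear[THEN module_hom.diff]
  operators_linear[THEN module_hom.scale]

lemma monomial_operators [simp]:
  "sigma (mon a b) = mon b a"
  "xi1 (mon a b) = scl (if even a then 1 else - 1) (mon a b)"
  "xi2 (mon a b) = scl (if even b then 1 else - 1) (mon a b)"
  "partial1 (mon a b) = scl (of_int a) (mon (a - 1) b)"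
  "partial2 (mon a b) = scl (of_int b) (mon a (b - 1))"
  by (simp_all add: sigma_def xi1_def xi2_def partial1_def partial2_def power_int_minus_left)

lemma sigma_zero [simp]: "sigma 0 = 0"
  by (simp add: sigma_def)

lemma sigma_sigma [simp]: "sigma (sigma f) = f"
  by (induction f rule: laurent_induct) (simp_all add: operators_hom)

text \<open>Multiplicativity lets \<open>sigma\<close> be applied to the equations that characterise the quotients in the
  Dunkl operators.\<close>

lemma sigma_mult: "sigma (f * g) = sigma f * sigma g"
proof (induction f rule: laurent_induct)
  case (mon a b)
  show ?case
    by (induction g rule: laurent_induct)
       (simp_all add: operators_hom mon_mult distrib_left scl_mult)
qed (simp_all add: operators_hom distrib_right scl_mult)

lemma sigma_xi1: "sigma (xi1 f) = xi2 (sigma f)"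
  and sigma_xi2: "sigma (xi2 f) = xi1 (sigma f)"
  and xi2_xi1: "xi2 (xi1 f) = xi1 (xi2 f)"
  by (induction f rule: laurent_induct) (simp_all add: operators_hom)

lemma quot_cancel: "\<exists>!h. g * h = f \<Longrightarrow> g * quot f g = f"
  unfolding quot_def by (rule theI')

lemma x_cancel:
  fixes h h' :: "'k::field laurent"
  shows "(mon 1 0 - mon 0 1) * h = (mon 1 0 - mon 0 1) * h' \<Longrightarrow> h = h'"
    and "(mon 1 0 + mon 0 1) * h = (mon 1 0 + mon 0 1) * h' \<Longrightarrow> h = h'"
proof -
  have m: "mon 1 0 + scl (-1) (mon 0 1) = (mon 1 0 - mon 0 1 :: 'k laurent)"
    by (rule poly_mapping_eqI) (simp add: lookup_add lookup_minus)
  show "(mon 1 0 - mon 0 1) * h = (mon 1 0 - mon 0 1) * h' \<Longrightarrow> h = h'"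
    using binomial_cancel[of "-1" "h - h'", unfolded m] by (simp add: right_diff_distrib)
  show "(mon 1 0 + mon 0 1) * h = (mon 1 0 + mon 0 1) * h' \<Longrightarrow> h = h'"
    using binomial_cancel[of 1 "h - h'"] by (simp add: right_diff_distrib)
qed

lemma x_square_diff_cancel:
  fixes h h' :: "'k::field laurent"
  assumes "(mon 2 0 - mon 0 2) * h = (mon 2 0 - mon 0 2) * h'"
  shows "h = h'"
proof -
  have "mon 2 0 - mon 0 2 = ((mon 1 0 - mon 0 1) * (mon 1 0 + mon 0 1) :: 'k laurent)"
    by (simp add: algebra_simps mon_mult)
  with assms show ?thesis
    by (auto simp: mult.assoc dest!: x_cancel)
qed

text \<open>The two quotients multiplied by \<open>c0\<close> in the Dunkl operators.  The second one is composed with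
  \<open>sigma\<close>, because the operators occur in $g_1(x_1y_1-x_2y_2)$, where $g_1$ contains \<open>sigma\<close>.\<close>

definition sigma_quot :: "'k::field laurent \<Rightarrow> 'k laurent" where
  "sigma_quot f = quot (f - sigma f) (mon 1 0 - mon 0 1)"

definition xi_sigma_quot :: "'k::field laurent \<Rightarrow> 'k laurent" where
  "xi_sigma_quot f = sigma (quot (f - xi1 (xi2 (sigma f))) (mon 1 0 + mon 0 1))"

lemma sigma_quot: "(mon 1 0 - mon 0 1) * sigma_quot f = f - sigma f"
  unfolding sigma_quot_def by (intro quot_cancel dunkl_quotients)

text \<open>The numerator $f - \sigma f$ and the denominator $x_1 - x_2$ both change sign under \<open>sigma\<close>.\<close>

lemma sigma_sigma_quot: "sigma (sigma_quot f) = sigma_quot f"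
proof -
  have "sigma ((mon 1 0 - mon 0 1) * sigma_quot f) = sigma f - f"
    by (simp add: sigma_quot operators_hom)
  then have "(mon 0 1 - mon 1 0) * sigma (sigma_quot f) = sigma f - f"
    by (simp add: sigma_mult operators_hom)
  then have "(mon 1 0 - mon 0 1) * sigma (sigma_quot f) = f - sigma f"
    by (metis minus_diff_eq mult_minus_left)
  also have "\<dots> = (mon 1 0 - mon 0 1) * sigma_quot f"
    by (rule sigma_quot[symmetric])
  finally show ?thesis by (rule x_cancel)
qed

lemma xi_sigma_quot: "(mon 1 0 + mon 0 1) * xi_sigma_quot f = sigma f - xi1 (xi2 f)"
proof -
  have "sigma ((mon 1 0 + mon 0 1) * quot (f - xi1 (xi2 (sigma f))) (mon 1 0 + mon 0 1))
      = sigma (f - xi1 (xi2 (sigma f)))"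
    by (subst quot_cancel) (rule dunkl_quotients, rule refl)
  then show ?thesis
    by (simp add: xi_sigma_quot_def sigma_mult operators_hom sigma_xi1 sigma_xi2 xi2_xi1 add.commute)
qed

text \<open>The summand \<open>scl \<kappa> (sigma E)\<close> below, with $E$ the operator
  $x_1\partial_1-x_2\partial_2$ applied to $f$, is what the first summand of $g_2$ compensates, and the
  summand with \<open>c1\<close> is what $g_4$ compensates.\<close>

lemma cg_operator_without_parameters:
  fixes f :: "'k::field_char_0 laurent"
  assumes "c0 \<noteq> 0"
  shows "cg_operator n \<kappa> c0 c1 f
    = scl (1 / 4) ((mon 1 0 + mon 0 1) * sigma_quot f - (mon 1 0 - mon 0 1) * xi_sigma_quot f)
      - scl (1 / (2 * of_nat n)) (mon 1 0 * partial1 f - mon 0 1 * partial2 f)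
      + (mon (-1) 1 - mon 1 (-1)) * g3 f"
proof -
  define E where "E = mon 1 0 * partial1 f - mon 0 1 * partial2 f"
  define D where "D = quot (f - xi1 (xi2 (sigma f))) (mon 1 0 + mon 0 1)"
  have q: "mon 1 0 * quot (f - xi1 f) (mon 1 0) = f - xi1 f"
    "mon 0 1 * quot (f - xi2 f) (mon 0 1) = f - xi2 f"
    by (intro quot_cancel dunkl_quotients)+
  have "mul1 (dunkl1 \<kappa> c0 c1 f) - mul2 (dunkl2 \<kappa> c0 c1 f)
    = scl \<kappa> E - scl c0 ((mon 1 0 + mon 0 1) * sigma_quot f) - scl c0 ((mon 1 0 - mon 0 1) * D)
      - scl c1 (mon 1 0 * quot (f - xi1 f) (mon 1 0) - mon 0 1 * quot (f - xi2 f) (mon 0 1))"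
    unfolding mul1_def mul2_def dunkl1_def dunkl2_def E_def D_def sigma_quot_def
    by (simp add: algebra_simps scl_mult)
  also have "\<dots> = scl \<kappa> E - scl c0 ((mon 1 0 + mon 0 1) * sigma_quot f)
      - scl c0 ((mon 1 0 - mon 0 1) * D) - scl c1 (xi2 f - xi1 f)"
    by (simp add: q)
  finally have "g1 c0 (mul1 (dunkl1 \<kappa> c0 c1 f) - mul2 (dunkl2 \<kappa> c0 c1 f))
    = scl (- 1 / (4 * c0)) (sigma (scl \<kappa> E - scl c0 ((mon 1 0 + mon 0 1) * sigma_quot f)
      - scl c0 ((mon 1 0 - mon 0 1) * D) - scl c1 (xi2 f - xi1 f)))"
    by (simp only: g1_def)
  also have "sigma (scl \<kappa> E - scl c0 ((mon 1 0 + mon 0 1) * sigma_quot f)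
      - scl c0 ((mon 1 0 - mon 0 1) * D) - scl c1 (xi2 f - xi1 f))
    = scl \<kappa> (sigma E) - scl c0 ((mon 1 0 + mon 0 1) * sigma_quot f)
      + scl c0 ((mon 1 0 - mon 0 1) * xi_sigma_quot f) - scl c1 (xi1 (sigma f) - xi2 (sigma f))"
    unfolding xi_sigma_quot_def D_def[symmetric]
    by (simp add: operators_hom sigma_mult sigma_sigma_quot sigma_xi1 sigma_xi2
          left_diff_distrib distrib_right scl.scale_right_diff_distrib scl.scale_right_distrib)
  finally have G: "g1 c0 (mul1 (dunkl1 \<kappa> c0 c1 f) - mul2 (dunkl2 \<kappa> c0 c1 f))
    = scl (- 1 / (4 * c0)) (scl \<kappa> (sigma E) - scl c0 ((mon 1 0 + mon 0 1) * sigma_quot f)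
      + scl c0 ((mon 1 0 - mon 0 1) * xi_sigma_quot f) - scl c1 (xi1 (sigma f) - xi2 (sigma f)))" .
  have M: "mul2 (mulinv1 (g3 f)) - mul1 (mulinv2 (g3 f)) = (mon (-1) 1 - mon 1 (-1)) * g3 f"
    by (simp add: mul1_def mul2_def mulinv1_def mulinv2_def left_diff_distrib mon_mult flip: mult.assoc)
  show ?thesis
    unfolding cg_operator_def G M
    unfolding g2_def g4_def mul1_def mul2_def E_def[symmetric]
    using assms
    by (intro poly_mapping_eqI, simp add: lookup_add lookup_minus) (simp add: field_simps)
qed

text \<open>Multiplication by $x_1^2-x_2^2=(x_1-x_2)(x_1+x_2)$ removes both quotients.  The right-hand side is
  manifestly linear in $f$ and explicit on monomials, and the factor can be cancelled; so this equation
  determines the operator.\<close>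

lemma cg_operator_cleared:
  fixes f :: "'k::field_char_0 laurent"
  assumes "c0 \<noteq> 0"
  shows "(mon 2 0 - mon 0 2) * cg_operator n \<kappa> c0 c1 f
    = scl (1 / 4) ((mon 1 0 + mon 0 1)^2 * (f - sigma f)
                   - (mon 1 0 - mon 0 1)^2 * (sigma f - xi1 (xi2 f)))
      + (mon 2 0 - mon 0 2) * ((mon (-1) 1 - mon 1 (-1)) * g3 f
          - scl (1 / (2 * of_nat n)) (mon 1 0 * partial1 f - mon 0 1 * partial2 f))"
proof -
  let ?p = "mon 1 0 + mon 0 1 :: 'k laurent" and ?m = "mon 1 0 - mon 0 1 :: 'k laurent"
  have pm: "mon 2 0 - mon 0 2 = ?m * ?p"
    by (simp add: algebra_simps mon_mult)
  have cleared: "(m * p) * (scl (1 / 4) (p * u - m * v) - E + G)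
      = scl (1 / 4) (p^2 * (m * u) - m^2 * (p * v)) + (m * p) * (G - E)"
    for m p u v E G :: "'k laurent"
    by (simp add: scl_mult power2_eq_square algebra_simps)
  show ?thesis
    unfolding cg_operator_without_parameters[OF assms] pm cleared sigma_quot xi_sigma_quot ..
qed

text \<open>The monomials strictly between $x_1^bx_2^a$ and $x_1^ax_2^b$ on the progression that starts at
  $x_1^bx_2^a$ and has ratio $x_1^2x_2^{-2}$.  This progression reaches $x_1^ax_2^b$ only if $a-b$ is
  even, which is why the parity of $a-b$ enters below.\<close>

definition string_sum :: "int \<Rightarrow> int \<Rightarrow> 'k::field laurent" where
  "string_sum a b = (\<Sum>N | 1 \<le> N \<and> b + 2 * int N < a. mon (b + 2 * int N) (a - 2 * int N))"

text \<open>The value of \<open>cg_operator\<close> on $x_1^ax_2^b$, apart from the term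
  from $x_1\partial_1-x_2\partial_2$, changes sign if $a$ and $b$ are exchanged and \<open>sigma\<close> is
  applied.  It is split as \<open>cg_half a b - sigma (cg_half b a)\<close>, which turns the cases $a>b$ and
  $a<b$ into one.\<close>

definition cg_half :: "int \<Rightarrow> int \<Rightarrow> 'k::field laurent" where
  "cg_half a b = string_sum a b
     + (if b < a then scl (1 / 2) (mon b a + (if even (a - b) then mon a b else 0)) else 0)
     + (if odd a \<and> odd b then mon (a - 1) (b + 1) else 0)"

definition cg_monomial :: "nat \<Rightarrow> int \<Rightarrow> int \<Rightarrow> 'k::field laurent" where
  "cg_monomial n a b = cg_half a b - sigma (cg_half b a)
     - scl (of_int (a - b) / (2 * of_nat n)) (mon a b)"

text \<open>$x_1^2$ times a term is $x_2^2$ times the next one.\<close>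

lemma string_telescope:
  "(mon 2 0 - mon 0 2) * (\<Sum>N = 1..M. mon (b + 2 * int N) (a - 2 * int N))
     = mon (b + 2 * int M + 2) (a - 2 * int M) - (mon (b + 2) a :: 'k::field laurent)"
  by (induction M) (simp_all add: algebra_simps mon_mult)

lemma string_sum_cleared:
  assumes "b < a"
  shows "(mon 2 0 - mon 0 2) * string_sum a b
     = (if even (a - b) then mon a (b + 2) else mon (a + 1) (b + 1)) - (mon (b + 2) a :: 'k::field laurent)"
proof -
  \<comment> \<open>The largest \<open>N\<close> with \<open>b + 2 * N < a\<close>.\<close>
  define M where "M = nat ((a - b - 1) div 2)"
  have "{N. 1 \<le> N \<and> b + 2 * int N < a} = {1..M}"
    unfolding M_def using assms by auto
  then have "(mon 2 0 - mon 0 2) * string_sum a b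
     = mon (b + 2 * int M + 2) (a - 2 * int M) - (mon (b + 2) a :: 'k laurent)"
    by (simp add: string_sum_def string_telescope del: One_nat_def)
  moreover have "2 * int M = (if even (a - b) then a - b - 2 else a - b - 1)"
    unfolding M_def using assms by (cases "even (a - b)") (simp_all, presburger+)
  ultimately show ?thesis
    by (auto simp: algebra_simps)
qed

lemma string_sum_empty: "a \<le> b \<Longrightarrow> string_sum a b = 0"
  by (simp add: string_sum_def)

text \<open>The two ends of the telescoped string, together with half of the monomials at which the progression
  begins and, for even $a-b$, ends, give the numerator left by \<open>cg_operator_cleared\<close>.\<close>

lemma string_with_ends_cleared:
  fixes a b :: int
  assumes "b < a"
  defines "\<epsilon> \<equiv> if even (a - b) then 1 else - 1 :: 'k::field_char_0"
  shows "(mon 2 0 - mon 0 2) * (string_sum a b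
      + scl (1 / 2) (mon b a + (if even (a - b) then mon a b else 0)))
    = scl (1 / 4) ((mon 1 0 + mon 0 1)^2 * (mon a b - mon b a)
                   - (mon 1 0 - mon 0 1)^2 * (mon b a - scl \<epsilon> (mon a b)))"
proof -
  have 2: "2 * f = scl 2 f" "f * 2 = scl 2 f" for f :: "'k laurent"
    by (rule poly_mapping_eqI, simp only: mult_2 mult_2_right lookup_add lookup_scl)+
  show ?thesis
    unfolding distrib_left string_sum_cleared[OF assms(1)] \<epsilon>_def
    by (rule poly_mapping_eqI)
       (auto simp: power2_eq_square algebra_simps mon_mult scl_mult 2 lookup_add lookup_minus)
qed

lemma g3_mon: "g3 (mon a b) = (if odd a \<and> odd b then mon a b else 0 :: 'k::field_char_0 laurent)"
  by (rule poly_mapping_eqI) (simp add: g3_def operators_hom lookup_minus)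

text \<open>The terms with $g_3$ and $x_1\partial_1-x_2\partial_2$ are explicit on monomials.  For the rest,
  multiplied by $x_1^2-x_2^2$, the case $a>b$ is \<open>string_with_ends_cleared\<close>; $a<b$ follows from it by
  \<open>sigma\<close>, under which $x_1^2-x_2^2$ changes sign; for $a=b$ both sides vanish.\<close>

lemma cg_operator_mon:
  fixes c0 :: "'k::field_char_0"
  assumes "c0 \<noteq> 0"
  shows "cg_operator n \<kappa> c0 c1 (mon a b) = cg_monomial n a b"
proof (rule x_square_diff_cancel)
  define \<epsilon> where "\<epsilon> = (if even (a - b) then 1 else - 1 :: 'k)"
  define V where "V a b = string_sum a b
     + (if b < a then scl (1 / 2) (mon b a + (if even (a - b) then mon a b else 0)) else 0 :: 'k laurent)"
    for a b
  let ?d = "mon 2 0 - mon 0 2 :: 'k laurent"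
  have V0: "V a b = 0" if "a \<le> b" for a b
    using that by (simp add: V_def string_sum_empty)
  have V: "?d * V a b = scl (1 / 4) ((mon 1 0 + mon 0 1)^2 * (mon a b - mon b a)
      - (mon 1 0 - mon 0 1)^2 * (mon b a - scl (if even (a - b) then 1 else - 1) (mon a b)))"
    if "b < a" for a b
    unfolding V_def using that string_with_ends_cleared[of b a, where 'k = 'k] by simp
  have "?d * (V a b - sigma (V b a)) = scl (1 / 4) ((mon 1 0 + mon 0 1)^2 * (mon a b - mon b a)
      - (mon 1 0 - mon 0 1)^2 * (mon b a - scl \<epsilon> (mon a b)))"
  proof -
    consider "b < a" | "a < b" | "a = b" by linarith
    then show ?thesis
    proof cases
      case 1
      then show ?thesis using V[of b a] V0[of b a] by (simp add: \<epsilon>_def operators_hom)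
    next
      case 2
      let ?p = "mon 1 0 + mon 0 1 :: 'k laurent" and ?m = "mon 1 0 - mon 0 1 :: 'k laurent"
      \<comment> \<open>\<open>sigma\<close> fixes $x_1+x_2$ and negates $x_1-x_2$, so it fixes both squares.\<close>
      have p: "sigma (?p^2 * u) = ?p^2 * sigma u" for u
        by (simp add: power2_eq_square sigma_mult operators_hom add.commute)
      have m: "sigma (?m^2 * u) = ?m^2 * sigma u" for u
        using power2_commute[of "mon 0 1" "mon 1 0 :: 'k laurent"]
        by (simp add: power2_eq_square sigma_mult operators_hom)
      have "sigma (?d * V b a) = - (?d * sigma (V b a))"
        by (simp add: sigma_mult operators_hom left_diff_distrib)
      then have "?d * (V a b - sigma (V b a)) = sigma (?d * V b a)"
        using 2 by (simp add: V0 right_diff_distrib)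
      moreover have "even (b - a) = even (a - b)"
        by auto
      ultimately show ?thesis
        unfolding V[OF 2] operators_hom p m by (simp add: \<epsilon>_def)
    next
      case 3
      then show ?thesis by (simp add: \<epsilon>_def V0 operators_hom)
    qed
  qed
  moreover have "xi1 (xi2 (mon a b)) = scl \<epsilon> (mon a b)"
    by (simp add: \<epsilon>_def operators_hom)
  moreover have "cg_monomial n a b = V a b - sigma (V b a) + ((mon (-1) 1 - mon 1 (-1)) * g3 (mon a b)
          - scl (1 / (2 * of_nat n)) (mon 1 0 * partial1 (mon a b) - mon 0 1 * partial2 (mon a b)))"
  proof -
    have "cg_half a b = V a b + (if odd a \<and> odd b then mon (a - 1) (b + 1) else 0)" for a b
      by (simp add: cg_half_def V_def)
    moreover have "scl (1 / (2 * of_nat n)) (mon 1 0 * partial1 (mon a b) - mon 0 1 * partial2 (mon a b))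
        = scl (of_int (a - b) / (2 * of_nat n)) (mon a b :: 'k laurent)"
      by (intro poly_mapping_eqI)
         (simp add: scl_mult mon_mult lookup_minus left_diff_distrib diff_divide_distrib)
    ultimately show ?thesis
      by (simp add: cg_monomial_def g3_mon operators_hom mon_mult left_diff_distrib add.commute)
  qed
  ultimately show "?d * cg_operator n \<kappa> c0 c1 (mon a b) = ?d * cg_monomial n a b"
    unfolding cg_operator_cleared[OF assms] by (simp add: distrib_left)
qed

text \<open>A quotient is specified only by the equation that it solves; linearity is therefore read off from the
  equation without quotients, both sides of which can be divided by $x_1^2-x_2^2$.\<close>

lemma linear_map_cg_operator:
  fixes c0 :: "'k::field_char_0"
  assumes "c0 \<noteq> 0"
  shows "linear_map (cg_operator n \<kappa> c0 c1)"
proof unfold_locales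
  have linear: "linear_map (\<lambda>f. scl (1 / 4) ((mon 1 0 + mon 0 1)^2 * (f - sigma f)
                   - (mon 1 0 - mon 0 1)^2 * (sigma f - xi1 (xi2 f)))
      + (mon 2 0 - mon 0 2) * ((mon (-1) 1 - mon 1 (-1)) * g3 f
          - scl (1 / (2 * of_nat n)) (mon 1 0 * partial1 f - mon 0 1 * partial2 f)) :: 'k laurent)"
    unfolding g3_def
    by (intro scl_pair.module_hom_add scl_pair.module_hom_sub scl_pair.module_hom_scale
      linear_map_comp[OF linear_map_mult] linear_map_comp[OF operators_linear(2)]
      operators_linear scl.module_hom_ident)
  show "cg_operator n \<kappa> c0 c1 (f + g) = cg_operator n \<kappa> c0 c1 f + cg_operator n \<kappa> c0 c1 g" for f g
    by (rule x_square_diff_cancel)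
       (simp only: distrib_left cg_operator_cleared[OF assms] module_hom.add[OF linear])
  show "cg_operator n \<kappa> c0 c1 (scl c f) = scl c (cg_operator n \<kappa> c0 c1 f)" for c f
    by (rule x_square_diff_cancel)
       (simp only: scl_mult cg_operator_cleared[OF assms] module_hom.scale[OF linear])
qed


section \<open>The order on roots\<close>

lemma lookup_root: "Poly_Mapping.lookup (root a b) s = (if a \<le> s \<and> s < b then 1 else 0)"
  by (simp add: root_def simple_root_def lookup_sum lookup_single when_def)

lemma keys_root: "Poly_Mapping.keys (root a b) = {a..<b}"
  by (auto simp: in_keys_iff lookup_root split: if_splits)

lemma root_inject:
  assumes "a < b" "root a b = root c d"
  shows "a = c \<and> b = d"
proof -
  have "{a..<b} = {c..<d}"
    using assms(2) by (metis keys_root)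
  moreover from this have "c < d"
    using assms(1) by (metis atLeastLessThan_empty_iff)
  ultimately show ?thesis
    using assms(1) by (simp add: atLeastLessThan_eq_iff)
qed

lemma lin_ext_root: "lin_ext \<phi> (root a b) = (\<Sum>s = a..<b. \<phi> s)"
  by (simp add: root_def simple_root_def lin_ext_sum)

text \<open>For $q=n-2$ the removed simple root is $\alpha_2$.  A root avoiding it is either $\alpha_1$, which is
  sent to $\alpha_{n-1}$, or a sum of $\alpha_s$ with $s\ge3$, and then every index drops by 2.\<close>

lemma zeta_graph_iff:
  assumes "n \<ge> 3"
  shows "(\<rho>, \<mu>) \<in> zeta_graph (n - 2) n \<longleftrightarrow>
    (\<exists>a b. 1 \<le> a \<and> a < b \<and> b + 2 \<le> n \<and> \<rho> = root (a + 2) (b + 2) \<and> \<mu> = root a b)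
    \<or> (\<rho> = root 1 2 \<and> \<mu> = root (n - 1) n)"
proof -
  let ?\<zeta> = "lin_ext (\<lambda>s. simple_root ((s + (n - 2)) mod n))"
  have shift: "?\<zeta> (root (a + 2) (b + 2)) = root a b" if "b + 2 \<le> n" for a b
  proof -
    have eq: "s + 2 + (n - 2) = s + n" for s
      using assms by simp
    have "?\<zeta> (root (a + 2) (b + 2)) = (\<Sum>s = a + 2..<b + 2. simple_root ((s + (n - 2)) mod n))"
      by (rule lin_ext_root)
    also have "\<dots> = (\<Sum>s = a..<b. simple_root ((s + 2 + (n - 2)) mod n))"
      by (rule sum.shift_bounds_nat_ivl)
    also have "\<dots> = root a b"
      unfolding root_def eq using that by (intro sum.cong) auto
    finally show ?thesis .
  qed
  have wrap: "?\<zeta> (root 1 2) = root (n - 1) n"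
  proof -
    have "{1..<2::nat} = {1}" "{n - 1..<n} = {n - 1}" "1 + (n - 2) = n - 1"
      using assms by auto
    then show ?thesis
      unfolding lin_ext_root using assms by (simp add: root_def)
  qed
  have "(\<rho>, \<mu>) \<in> zeta_graph (n - 2) n \<longleftrightarrow>
      (\<exists>a b. 1 \<le> a \<and> a < b \<and> b \<le> n \<and> {a..<b} \<subseteq> {1..n - 1} - {2} \<and> \<rho> = root a b \<and> \<mu> = ?\<zeta> (root a b))"
  proof -
    have "n - (n - 2) = 2" using assms by simp
    then show ?thesis
      unfolding zeta_graph_def pos_roots_def by (auto simp: keys_root) blast
  qed
  also have "\<dots> \<longleftrightarrow> (\<exists>a b. (2 < a \<and> a < b \<and> b \<le> n \<or> a = 1 \<and> b = 2) \<and> \<rho> = root a b \<and> \<mu> = ?\<zeta> (root a b))"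
  proof -
    have "1 \<le> a \<and> a < b \<and> b \<le> n \<and> {a..<b} \<subseteq> {1..n - 1} - {2}
        \<longleftrightarrow> 2 < a \<and> a < b \<and> b \<le> n \<or> a = 1 \<and> b = 2" for a b
      using assms by (auto simp: subset_iff Ball_def) presburger+
    then show ?thesis by (intro ex_cong1) blast
  qed
  also have "\<dots> \<longleftrightarrow> (\<exists>a b. 2 < a \<and> a < b \<and> b \<le> n \<and> \<rho> = root a b \<and> \<mu> = ?\<zeta> (root a b))
      \<or> (\<rho> = root 1 2 \<and> \<mu> = root (n - 1) n)"
    by (simp only: conj_disj_distribR ex_disj_distrib conj_assoc simp_thms ex_simps wrap)
  also have "(\<exists>a b. 2 < a \<and> a < b \<and> b \<le> n \<and> \<rho> = root a b \<and> \<mu> = ?\<zeta> (root a b))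
      \<longleftrightarrow> (\<exists>a b. 1 \<le> a \<and> a < b \<and> b + 2 \<le> n \<and> \<rho> = root (a + 2) (b + 2) \<and> \<mu> = root a b)"
    (is "?L \<longleftrightarrow> ?R")
  proof
    assume ?L
    then obtain a b where ab: "2 < a" "a < b" "b \<le> n" "\<rho> = root a b" "\<mu> = ?\<zeta> (root a b)"
      by blast
    define a' b' where "a' = a - 2" and "b' = b - 2"
    have "a = a' + 2" "b = b' + 2"
      using ab by (simp_all add: a'_def b'_def)
    then show ?R
      using ab shift[of b' a'] by (intro exI[of _ a'] exI[of _ b']) simp
  next
    assume ?R
    then obtain a b where "1 \<le> a" "a < b" "b + 2 \<le> n" "\<rho> = root (a + 2) (b + 2)" "\<mu> = root a b"
      by blast
    then show ?L
      using shift[of b a] by (intro exI[of _ "a + 2"] exI[of _ "b + 2"]) simp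
  qed
  finally show ?thesis .
qed

lemma root_prec_iff_trancl: "root_prec q n \<rho> \<mu> \<longleftrightarrow> (\<rho>, \<mu>) \<in> (zeta_graph q n)\<^sup>+"
  by (auto simp: root_prec_def trancl_power Suc_le_eq)

lemma zeta_graph_shift:
  assumes "n \<ge> 3" "1 \<le> a" "a < b" "b + 2 * N \<le> n"
  shows "(root (a + 2 * N) (b + 2 * N), root a b) \<in> (zeta_graph (n - 2) n)\<^sup>*"
  using assms(4)
proof (induction N)
  case (Suc N)
  have "(root (a + 2 * N + 2) (b + 2 * N + 2), root (a + 2 * N) (b + 2 * N)) \<in> zeta_graph (n - 2) n"
    unfolding zeta_graph_iff[OF assms(1)] using Suc.prems assms(2,3)
    by (intro disjI1 exI[of _ "a + 2 * N"] exI[of _ "b + 2 * N"]) simp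
  with Suc show ?case
    by (simp add: converse_rtrancl_into_rtrancl)
qed simp

text \<open>A chain of shifts by $-2$ can be continued past the bottom only at $\alpha_1$, hence only for simple
  roots of odd index; it then restarts at $\alpha_{n-1}$, which has even index as $n$ is odd, and ends
  at $\alpha_2$.\<close>

lemma root_prec_iff:
  assumes n: "n \<ge> 3" "odd n" and "(a, b) \<in> index_pairs n" "(c, d) \<in> index_pairs n"
  shows "root_prec (n - 2) n (root a b) (root c d) \<longleftrightarrow>
    (\<exists>N\<ge>1. a = c + 2 * N \<and> b = d + 2 * N) \<or> (odd a \<and> even c \<and> b = a + 1 \<and> d = c + 1)"
proof -
  let ?Z = "zeta_graph (n - 2) n"
  define R where "R c d \<longleftrightarrow>
    (\<exists>N\<ge>1. a = c + 2 * N \<and> b = d + 2 * N) \<or> (odd a \<and> even c \<and> b = a + 1 \<and> d = c + 1)" for c d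
  have ab: "1 \<le> a" "a < b" "b \<le> n" and cd: "1 \<le> c" "c < d" "d \<le> n"
    using assms by (auto simp: index_pairs_def)
  have "\<exists>c d. c < d \<and> \<mu> = root c d \<and> R c d" if "(root a b, \<mu>) \<in> ?Z\<^sup>+" for \<mu>
    using that
  proof (induction rule: trancl_induct)
    case (base \<mu>)
    then consider a' b' where "a' < b'" "root a b = root (a' + 2) (b' + 2)" "\<mu> = root a' b'"
      | "root a b = root 1 2" "\<mu> = root (n - 1) n"
      unfolding zeta_graph_iff[OF n(1)] by blast
    then show ?case
    proof cases
      case 1
      then have "R a' b'"
        using root_inject[OF ab(2) 1(2)] unfolding R_def by (intro disjI1 exI[of _ 1]) simp
      then show ?thesis using 1 by blast
    next
      case 2
      then have "R (n - 1) n"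
        using root_inject[OF ab(2) 2(1)] n unfolding R_def by auto
      then show ?thesis using 2 n by (intro exI[of _ "n - 1"] exI[of _ n]) simp
    qed
  next
    case (step \<mu> \<nu>)
    then obtain c d where cd: "c < d" "\<mu> = root c d" "R c d" by blast
    from step.hyps(2) consider a' b' where "a' < b'" "root c d = root (a' + 2) (b' + 2)" "\<nu> = root a' b'"
      | "root c d = root 1 2" "\<nu> = root (n - 1) n"
      unfolding zeta_graph_iff[OF n(1)] cd(2) by blast
    then show ?case
    proof cases
      case 1
      then have "c = a' + 2" "d = b' + 2"
        using root_inject[OF cd(1)] by auto
      then consider N where "a = a' + 2 * (N + 1)" "b = b' + 2 * (N + 1)"
        | "odd a" "even a'" "b = a + 1" "b' = a' + 1"
        using cd(3) unfolding R_def by auto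
      then have "R a' b'"
        unfolding R_def by cases (metis le_add2, blast)
      then show ?thesis using 1 by blast
    next
      case 2
      then have "c = 1" "d = 2"
        using root_inject[OF cd(1)] by auto
      then have "R (n - 1) n"
        using cd(3) n unfolding R_def by auto
      then show ?thesis using 2 n by (intro exI[of _ "n - 1"] exI[of _ n]) simp
    qed
  qed
  then have "R c d" if "(root a b, root c d) \<in> ?Z\<^sup>+"
    using that root_inject[OF cd(2)] by metis
  moreover have "(root a b, root c d) \<in> ?Z\<^sup>+" if "R c d"
    using that unfolding R_def
  proof (elim disjE exE conjE)
    fix N assume N: "N \<ge> (1::nat)" "a = c + 2 * N" "b = d + 2 * N"
    then have "(root a b, root c d) \<in> ?Z\<^sup>*"
      using zeta_graph_shift[of n c d N] n ab cd by auto
    moreover have "root a b \<noteq> root c d"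
      using root_inject[OF ab(2), of c d] N by auto
    ultimately show ?thesis
      by (metis rtranclD)
  next
    assume odd: "odd a" "even c" "b = a + 1" "d = c + 1"
    obtain k where k: "a = 2 * k + 1" using odd(1) by (elim oddE)
    have "even (n - 1 - c)"
      using odd n cd by auto
    then obtain l where l: "n - 1 - c = 2 * l" by (elim evenE)
    have "(root a b, root 1 2) \<in> ?Z\<^sup>*"
      using zeta_graph_shift[of n 1 2 k] n ab odd k by (simp add: numeral_2_eq_2)
    moreover have "(root 1 2, root (n - 1) n) \<in> ?Z"
      unfolding zeta_graph_iff[OF n(1)] by blast
    moreover have "(root (n - 1) n, root c d) \<in> ?Z\<^sup>*"
    proof -
      have "c + 2 * l = n - 1" "d + 2 * l = n"
        using l odd cd by auto
      then show ?thesis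
        using zeta_graph_shift[of n c d l] n cd by simp
    qed
    ultimately show ?thesis
      by (meson rtrancl_into_trancl1 trancl_rtrancl_trancl)
  qed
  ultimately show ?thesis
    unfolding root_prec_iff_trancl R_def[symmetric] by blast
qed


section \<open>The r-matrix acting on monomials\<close>

lemma linear_map_tensor_to_pol: "linear_map tensor_to_pol"
  by (simp add: tensor_to_pol_def linear_map_lin_ext)

lemma linear_map_tensor_act_matrix: "linear_map (\<lambda>R. tensor_act R t)"
  by (simp add: tensor_act_def linear_map_lin_ext)

lemma linear_map_tensor_act: "linear_map (tensor_act R)"
  unfolding tensor_act_def lin_ext_def[of _ R]
  by (intro scl_pair.module_hom_sum scl_pair.module_hom_scale)
     (auto simp: split_def linear_map_lin_ext scl.module_axioms)

text \<open>The index conditions of both summands are kept as they are produced by the matrix units; every sum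
  in the r-matrix is evaluated from this one formula.\<close>

lemma tensor_act_wedge:
  "tensor_to_pol (tensor_act (wedge (e_mat a b) (e_mat c d)) (Poly_Mapping.single (i, j) 1))
   = scl (1 / 2) ((if b = i \<and> d = j then mon (int a - 1) (int c - 1) else 0)
       - (if d = i \<and> b = j then mon (int c - 1) (int a - 1) else 0) :: 'k::field laurent)"
proof -
  have [simp]: "mat_act (e_mat a b) (e_vec i :: _ \<Rightarrow>\<^sub>0 'k) = (if b = i then e_vec a else 0)" for a b i
    by (simp add: mat_act_def e_mat_def e_vec_def)
  have [simp]: "tensor (e_vec a) (e_vec c) = (Poly_Mapping.single (a, c) 1 :: _ \<Rightarrow>\<^sub>0 'k)"
    "tensor 0 v = (0 :: nat \<times> nat \<Rightarrow>\<^sub>0 'k)" "tensor (e_vec a) 0 = (0 :: nat \<times> nat \<Rightarrow>\<^sub>0 'k)"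
    for a c :: nat and v :: "nat \<Rightarrow>\<^sub>0 'k"
    by (simp_all add: tensor_def e_vec_def)
  have "wedge (e_mat a b) (e_mat c d) = scl (1 / 2)
      (Poly_Mapping.single ((a, b), (c, d)) 1 - Poly_Mapping.single ((c, d), (a, b)) (1 :: 'k))"
    by (simp add: wedge_def tensor_def e_mat_def)
  moreover have "tensor_to_pol (tensor_act (Poly_Mapping.single ((a, b), (c, d)) 1)
      (Poly_Mapping.single (i, j) 1)) = (if b = i \<and> d = j then mon (int a - 1) (int c - 1) else 0 :: 'k laurent)"
    for a b c d
    by (simp add: tensor_act_def tensor_to_pol_def)
  ultimately show ?thesis
    by (simp only: linear_map_tensor_act_matrix[THEN module_hom.scale]
          linear_map_tensor_act_matrix[THEN module_hom.diff]
          linear_map_tensor_to_pol[THEN module_hom.scale] linear_map_tensor_to_pol[THEN module_hom.diff])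
qed

lemma sum_index_pairs_delta:
  assumes "i \<in> {1..n}" "j \<in> {1..n}"
  shows "(\<Sum>(a, b)\<in>index_pairs n. if a = i \<and> b = j then f a b else 0)
    = (if i < j then f i j else 0 :: 'k::comm_monoid_add)"
proof -
  have "finite (index_pairs n)"
    by (rule finite_subset[of _ "{1..n} \<times> {1..n}"]) (auto simp: index_pairs_def)
  have "(case p of (a, b) \<Rightarrow> if a = i \<and> b = j then f a b else 0) = (if p = (i, j) then f i j else 0)" for p
    by (cases p; cases "p = (i, j)") auto
  then have "(\<Sum>(a, b)\<in>index_pairs n. if a = i \<and> b = j then f a b else 0)
      = (\<Sum>p\<in>index_pairs n. if p = (i, j) then f i j else 0)"
    by simp
  also have "\<dots> = (if i < j then f i j else 0)"
    using assms \<open>finite (index_pairs n)\<close> by (simp add: index_pairs_def)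
  finally show ?thesis .
qed

definition prec_pairs :: "nat \<Rightarrow> ((nat \<times> nat) \<times> (nat \<times> nat)) set" where
  "prec_pairs n = {((a, b), (c, d)). (a, b) \<in> index_pairs n \<and> (c, d) \<in> index_pairs n
               \<and> root_prec (n - 2) n (root a b) (root c d)}"

lemma finite_prec_pairs: "finite (prec_pairs n)"
  by (rule finite_subset[of _ "({1..n} \<times> {1..n}) \<times> ({1..n} \<times> {1..n})"])
     (auto simp: prec_pairs_def index_pairs_def)

text \<open>The part $\sum e_{ab}\otimes e_{dc}$ of the first sum of the r-matrix, applied to
  $e_i\otimes e_j$: only pairs with $b=i$ and $c=j$ contribute.  For shifted roots these are
  parametrised by the shift $N$, for simple roots there is at most one.\<close>

lemma prec_pairs_sum:
  assumes n: "n \<ge> 3" "odd n" and ij: "i \<in> {1..n}" "j \<in> {1..n}"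
  shows "(\<Sum>((a, b), (c, d))\<in>prec_pairs n. if b = i \<and> c = j then mon (int a - 1) (int d - 1) else 0)
    = string_sum (int i - 1) (int j - 1)
      + (if even i \<and> even j then mon (int i - 2) (int j) else 0 :: 'k::field laurent)"
proof -
  \<comment> \<open>\<open>S\<close> collects the shifted roots, \<open>T\<close> the simple roots of odd and even index.\<close>
  define S where "S = (\<lambda>N. ((j + 2 * N, i), (j, i - 2 * N))) ` {N. 1 \<le> N \<and> j + 2 * N < i}"
  define T where "T = (if even i \<and> even j then {((i - 1, i), (j, j + 1))} else {})"
  let ?g = "\<lambda>((a, b), (c, d)). mon (int a - 1) (int d - 1) :: 'k laurent"
  have fin: "finite {N. 1 \<le> N \<and> j + 2 * N < i}"
    by (rule finite_subset[of _ "{..<i}"]) auto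
  have "p \<in> prec_pairs n \<and> snd (fst p) = i \<and> fst (snd p) = j \<longleftrightarrow> p \<in> S \<union> T" for p
  proof -
    obtain a b c d where p: "p = ((a, b), (c, d))" by (metis surj_pair)
    have "p \<in> prec_pairs n \<longleftrightarrow> (a, b) \<in> index_pairs n \<and> (c, d) \<in> index_pairs n \<and>
      ((\<exists>N\<ge>1. a = c + 2 * N \<and> b = d + 2 * N) \<or> (odd a \<and> even c \<and> b = a + 1 \<and> d = c + 1))"
      unfolding p prec_pairs_def using root_prec_iff[OF n] by auto
    moreover have "(a, i) \<in> index_pairs n \<and> (j, d) \<in> index_pairs n \<and> (\<exists>N\<ge>1. a = j + 2 * N \<and> i = d + 2 * N)
        \<longleftrightarrow> (\<exists>N\<ge>1. a = j + 2 * N \<and> i = d + 2 * N \<and> a < i)"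
      using ij by (auto simp: index_pairs_def)
    moreover have "(a, i) \<in> index_pairs n \<and> (j, d) \<in> index_pairs n \<and> odd a \<and> even j \<and> i = a + 1 \<and> d = j + 1
        \<longleftrightarrow> even i \<and> even j \<and> a = i - 1 \<and> d = j + 1"
      using ij n unfolding index_pairs_def atLeastAtMost_iff mem_Collect_eq prod.case by presburger
    moreover have "p \<in> S \<longleftrightarrow> b = i \<and> c = j \<and> (\<exists>N\<ge>1. a = j + 2 * N \<and> i = d + 2 * N \<and> a < i)"
    proof -
      have "d = i - 2 * N \<and> j + 2 * N < i \<longleftrightarrow> i = d + 2 * N \<and> j + 2 * N < i" for N
        by linarith
      then show ?thesis
        unfolding p S_def image_iff mem_Collect_eq Bex_def prod.inject by metis
    qed
    moreover have "p \<in> T \<longleftrightarrow> b = i \<and> c = j \<and> even i \<and> even j \<and> a = i - 1 \<and> d = j + 1"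
      by (auto simp: p T_def)
    ultimately show ?thesis
      unfolding p fst_conv snd_conv Un_iff by metis
  qed
  then have eq: "{p \<in> prec_pairs n. snd (fst p) = i \<and> fst (snd p) = j} = S \<union> T"
    by blast
  have "S \<inter> T = {}"
    by (auto simp: S_def T_def) presburger
  have "(\<Sum>((a, b), (c, d))\<in>prec_pairs n. if b = i \<and> c = j then mon (int a - 1) (int d - 1) else 0)
      = (\<Sum>p\<in>prec_pairs n. if snd (fst p) = i \<and> fst (snd p) = j then ?g p else 0)"
    by (intro sum.cong) auto
  also have "\<dots> = sum ?g (S \<union> T)"
    unfolding eq[symmetric] by (rule sum.inter_filter[OF finite_prec_pairs, symmetric])
  also have "\<dots> = sum ?g S + sum ?g T"
    using \<open>S \<inter> T = {}\<close> fin by (intro sum.union_disjoint) (auto simp: S_def T_def)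
  also have "sum ?g S = string_sum (int i - 1) (int j - 1)"
  proof -
    have "sum ?g S = (\<Sum>N | 1 \<le> N \<and> j + 2 * N < i. mon (int (j + 2 * N) - 1) (int (i - 2 * N) - 1))"
      unfolding S_def by (subst sum.reindex) (auto simp: inj_on_def)
    also have "\<dots> = string_sum (int i - 1) (int j - 1)"
      unfolding string_sum_def by (intro sum.cong) (auto simp: algebra_simps of_nat_diff)
    finally show ?thesis .
  qed
  also have "sum ?g T = (if even i \<and> even j then mon (int i - 2) (int j) else 0)"
    using ij by (auto simp: T_def of_nat_diff)
  finally show ?thesis .
qed

lemma modular_inverse_minus_two:
  assumes "n \<ge> 3" "odd n"
  shows "modular_inverse (int n) (int (n - 2)) = (int n - 1) div 2"
proof (rule modular_inverse_int_eqI)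
  obtain m where m: "n = 2 * m + 1" using assms by (elim oddE)
  show "(int n - 1) div 2 \<in> {0..<int n}"
    unfolding m by auto
  have "int (n - 2) * ((int n - 1) div 2) = int n * (int m - 1) + 1"
    using assms unfolding m by (simp add: of_nat_diff algebra_simps)
  then show "[int (n - 2) * ((int n - 1) div 2) = 1] (mod int n)"
    by (simp add: Cong.cong_def)
qed

text \<open>With $d=j-i$ and $(n-1)/2$ as the inverse of $n-2$, the residue is the half of $d$ modulo $n$:
  it is $d/2$ for even $d$ and $(d+n)/2$ for odd $d$.\<close>

lemma diagonal_coefficient:
  assumes "n \<ge> 3" "odd n" "(i, j) \<in> index_pairs n"
  shows "- 1 + 2 / of_nat n * of_int (((int i - int j) * modular_inverse (int n) (int (n - 2))) mod int n)
    = (of_int (int j - int i) / of_nat n - (if even (i + j) then 1 else 0) :: 'k::field_char_0)"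
proof -
  define d where "d = int j - int i"
  have d: "0 < d" "d < int n" "even (i + j) \<longleftrightarrow> even d"
    using assms(3) by (auto simp: d_def index_pairs_def)
  have "((int i - int j) * ((int n - 1) div 2)) mod int n = (if even d then d div 2 else (d + int n) div 2)"
  proof -
    obtain m where m: "int n = 2 * m + 1" using assms by (metis even_of_nat oddE)
    have "int i - int j = - d" by (simp add: d_def)
    moreover have "(- d * m) mod int n = (if even d then d div 2 else (d + int n) div 2)"
    proof (cases "even d")
      case True
      then obtain k where k: "d = 2 * k" by (elim evenE)
      have "- d * m = k + (- k) * int n" unfolding k m by (simp add: algebra_simps)
      then have "(- d * m) mod int n = k mod int n" by (metis mod_mult_self1)
      then show ?thesis using d k by simp
    next
      case False
      then obtain k where k: "d = 2 * k + 1" by (elim oddE)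
      have "- d * m = (k + m + 1) + (- k - 1) * int n" unfolding k m by (simp add: algebra_simps)
      then have "(- d * m) mod int n = (k + m + 1) mod int n" by (metis mod_mult_self1)
      then show ?thesis using d k m by simp
    qed
    ultimately show ?thesis by (simp add: m)
  qed
  moreover have "(2 * of_int ((d + int n) div 2) :: 'k) = of_int d + of_nat n" if "odd d"
  proof -
    have "2 * ((d + int n) div 2) = d + int n" using that assms by simp
    then have "of_int (2 * ((d + int n) div 2)) = (of_int (d + int n) :: 'k)" by simp
    then show ?thesis by simp
  qed
  moreover have "(2 * of_int (d div 2) :: 'k) = of_int d" if "even d"
  proof -
    have "of_int (2 * (d div 2)) = (of_int d :: 'k)" using that by simp
    then show ?thesis by simp
  qed
  ultimately show ?thesis
    using assms d unfolding modular_inverse_minus_two[OF assms(1,2)] d_def[symmetric]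
    by (simp add: field_simps)
qed

text \<open>The three sums of the r-matrix are evaluated separately and compared with \<open>cg_monomial\<close> in the three
  cases $i<j$, $i>j$ and $i=j$.  The $-\frac12$ in the diagonal coefficient for even $j-i$ is the half
  monomial that the operator leaves at the end of the string.\<close>

lemma cremmer_gervais_mon:
  assumes n: "n \<ge> 3" "odd n" and ij: "i \<in> {1..n}" "j \<in> {1..n}"
  shows "tensor_to_pol (tensor_act (cremmer_gervais (n - 2) n) (Poly_Mapping.single (i, j) 1))
    = (cg_monomial n (int i - 1) (int j - 1) :: 'k::field_char_0 laurent)"
proof -
  define A where "A = int i - 1"
  define B where "B = int j - 1"
  define F where "F R = (tensor_to_pol (tensor_act R (Poly_Mapping.single (i, j) 1)) :: 'k laurent)" for R
  have F: "linear_map F"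
    unfolding F_def
    by (intro linear_map_comp[OF linear_map_tensor_to_pol] linear_map_tensor_act_matrix)
  note F_hom = F[THEN module_hom.add] F[THEN module_hom.sum] F[THEN module_hom.scale]
  have wedge: "F (wedge (e_mat a b) (e_mat c d)) =
      scl (1 / 2) ((if b = i \<and> d = j then mon (int a - 1) (int c - 1) else 0)
       - (if d = i \<and> b = j then mon (int c - 1) (int a - 1) else 0))" for a b c d
    unfolding F_def by (rule tensor_act_wedge)
  define V where "V i j = (\<Sum>((a, b), (c, d))\<in>prec_pairs n.
      if b = i \<and> c = j then mon (int a - 1) (int d - 1) else 0 :: 'k laurent)" for i j
  have 1: "F (scl 2 (\<Sum>((a, b), (c, d))\<in>prec_pairs n. wedge (e_mat a b) (e_mat d c)))
     = V i j - sigma (V j i)"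
  proof -
    have "sigma (V j i) = (\<Sum>((a, b), (c, d))\<in>prec_pairs n.
      if c = i \<and> b = j then mon (int d - 1) (int a - 1) else 0 :: 'k laurent)"
      unfolding V_def operators_linear(1)[THEN module_hom.sum]
      by (intro sum.cong) auto
    then show ?thesis
      unfolding V_def F_hom scl.scale_sum_right by (simp add: split_def wedge flip: sum_subtractf)
  qed
  have 2: "F (\<Sum>(j, l) \<in> index_pairs n. scl (c j l) (wedge (e_mat j j) (e_mat l l)))
     = (if i < j then scl (c i j / 2) (mon A B) else 0) - (if j < i then scl (c j i / 2) (mon A B) else 0)"
    for c :: "nat \<Rightarrow> nat \<Rightarrow> 'k"
  proof -
    have "F (scl (c a b) (wedge (e_mat a a) (e_mat b b)))
      = (if a = i \<and> b = j then scl (c a b / 2) (mon A B) else 0)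
       - (if a = j \<and> b = i then scl (c a b / 2) (mon A B) else 0)" for a b
      unfolding F_hom wedge A_def B_def
      by (cases "i = j") (auto simp: scl.scale_right_diff_distrib)
    then have "F (\<Sum>(j, l) \<in> index_pairs n. scl (c j l) (wedge (e_mat j j) (e_mat l l)))
      = (\<Sum>(a, b)\<in>index_pairs n. if a = i \<and> b = j then scl (c a b / 2) (mon A B) else 0)
       - (\<Sum>(a, b)\<in>index_pairs n. if a = j \<and> b = i then scl (c a b / 2) (mon A B) else 0)"
      unfolding F_hom(2) by (simp only: split_def sum_subtractf)
    then show ?thesis
      unfolding sum_index_pairs_delta[OF ij] sum_index_pairs_delta[OF ij(2,1)] .
  qed
  have 3: "F (\<Sum>(j, l) \<in> index_pairs n. wedge (e_mat j l) (e_mat l j))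
     = (if j < i then scl (1 / 2) (mon B A) else 0) - (if i < j then scl (1 / 2) (mon B A) else 0)"
  proof -
    have "F (wedge (e_mat a b) (e_mat b a))
      = (if a = j \<and> b = i then scl (1 / 2) (mon B A) else 0)
       - (if a = i \<and> b = j then scl (1 / 2) (mon B A) else 0)" for a b
      unfolding wedge A_def B_def
      by (cases "i = j") (auto simp: scl.scale_right_diff_distrib)
    then have "F (\<Sum>(j, l) \<in> index_pairs n. wedge (e_mat j l) (e_mat l j))
      = (\<Sum>(a, b)\<in>index_pairs n. if a = j \<and> b = i then scl (1 / 2) (mon B A) else 0)
       - (\<Sum>(a, b)\<in>index_pairs n. if a = i \<and> b = j then scl (1 / 2) (mon B A) else 0)"
      unfolding F_hom(2) by (simp only: split_def sum_subtractf)
    then show ?thesis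
      unfolding sum_index_pairs_delta[OF ij] sum_index_pairs_delta[OF ij(2,1)] .
  qed
  define c where "c j l = (- 1 + 2 / of_nat n
      * of_int (((int j - int l) * modular_inverse (int n) (int (n - 2))) mod int n) :: 'k)" for j l
  have c: "c a b = of_int (int b - int a) / of_nat n - (if even (a + b) then 1 else 0)"
    if "a < b" "a \<in> {1..n}" "b \<in> {1..n}" for a b
    unfolding c_def using that by (intro diagonal_coefficient n) (simp add: index_pairs_def)
  have V: "V i j = string_sum A B + (if odd A \<and> odd B then mon (A - 1) (B + 1) else 0)"
    "V j i = string_sum B A + (if odd A \<and> odd B then mon (B - 1) (A + 1) else 0)"
    unfolding V_def prec_pairs_sum[OF n ij] prec_pairs_sum[OF n ij(2,1)] A_def B_def
    by auto
  have "F (cremmer_gervais (n - 2) n) = V i j - sigma (V j i)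
      + ((if i < j then scl (c i j / 2) (mon A B) else 0) - (if j < i then scl (c j i / 2) (mon A B) else 0))
      + ((if j < i then scl (1 / 2) (mon B A) else 0) - (if i < j then scl (1 / 2) (mon B A) else 0))"
    unfolding cremmer_gervais_def F_hom(1) 1[unfolded prec_pairs_def] 2 3 c_def ..
  also have "\<dots> = cg_monomial n A B"
  proof -
    have e: "even (A - B) \<longleftrightarrow> even (i + j)" "even (B - A) \<longleftrightarrow> even (i + j)" "even (j + i) \<longleftrightarrow> even (i + j)"
      "int j - int i = B - A" "int i - int j = A - B"
      by (auto simp: A_def B_def)
    consider "i < j" "A < B" | "j < i" "B < A" | "i = j" "A = B"
      unfolding A_def B_def by linarith
    then show ?thesis
    proof cases
      case 1
      then show ?thesis
        unfolding cg_monomial_def cg_half_def V e c[OF 1(1) ij]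
        by (intro poly_mapping_eqI)
           (use n in \<open>simp add: operators_hom lookup_add lookup_minus field_simps\<close>)
    next
      case 2
      then show ?thesis
        unfolding cg_monomial_def cg_half_def V e c[OF 2(1) ij(2,1)]
        by (intro poly_mapping_eqI)
           (use n in \<open>simp add: operators_hom lookup_add lookup_minus field_simps\<close>)
    next
      case 3
      then show ?thesis
        unfolding cg_monomial_def cg_half_def V by simp
    qed
  qed
  finally show ?thesis
    unfolding F_def A_def B_def .
qed


section \<open>Tensors, truncated polynomials and the algebra of operators\<close>

text \<open>The exponents of $e_j\otimes e_l$ determine $j$ and $l$, so no coefficients are merged.\<close>

lemma lookup_tensor_to_pol:
  "Poly_Mapping.lookup (tensor_to_pol t) (int j - 1, int l - 1) = Poly_Mapping.lookup t (j, l)"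
proof (induction t rule: poly_mapping_induct_add)
  case (single p c)
  show ?case
    by (cases p) (simp add: tensor_to_pol_def mon_def lookup_single when_def)
qed (simp_all add: tensor_to_pol_def lin_ext_add lookup_add)

lemma tensor_to_pol_bij: "bij_betw tensor_to_pol (tensor_square n) (TruncPol n :: 'k::field laurent set)"
  unfolding bij_betw_def
proof
  show "inj_on tensor_to_pol (tensor_square n :: (nat \<times> nat \<Rightarrow>\<^sub>0 'k) set)"
    by (intro inj_onI poly_mapping_eqI) (metis lookup_tensor_to_pol surj_pair)
  have "tensor_to_pol t \<in> TruncPol n" if "t \<in> tensor_square n" for t :: "nat \<times> nat \<Rightarrow>\<^sub>0 'k"
  proof -
    have "tensor_to_pol t
        = (\<Sum>p\<in>{1..n} \<times> {1..n}. scl (Poly_Mapping.lookup t p) (case p of (j, l) \<Rightarrow> mon (int j - 1) (int l - 1)))"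
      unfolding tensor_to_pol_def using that by (intro lin_ext_superset) (auto simp: tensor_square_def)
    also have "\<dots> = (\<Sum>j = Suc 0..n. \<Sum>l = Suc 0..n. scl (Poly_Mapping.lookup t (j, l)) (mon (int j - 1) (int l - 1)))"
      by (simp add: sum.cartesian_product split_def)
    also have "\<dots> = (\<Sum>j<n. \<Sum>l<n. scl (Poly_Mapping.lookup t (Suc j, Suc l)) (mon (int j) (int l)))"
      unfolding sum.atLeast1_atMost_eq by simp
    finally show ?thesis
      unfolding TruncPol_def
      by (intro CollectI exI[of _ "\<lambda>j l. Poly_Mapping.lookup t (Suc j, Suc l)"] conjI TrueI)
  qed
  moreover have "f \<in> tensor_to_pol ` tensor_square n" if f: "f \<in> TruncPol n" for f :: "'k laurent"
  proof -
    obtain a where a: "f = (\<Sum>j<n. \<Sum>l<n. scl (a j l) (mon (int j) (int l)))"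
      using f unfolding TruncPol_def by (elim CollectE exE conjE)
    define t where "t = (\<Sum>j<n. \<Sum>l<n. Poly_Mapping.single (Suc j, Suc l) (a j l))"
    have "Poly_Mapping.lookup t p = 0" if "p \<notin> {1..n} \<times> {1..n}" for p
      unfolding t_def lookup_sum lookup_single
      using that by (intro sum.neutral ballI) (auto simp: when_def)
    then have "t \<in> tensor_square n"
      by (auto simp: tensor_square_def in_keys_iff)
    moreover have "tensor_to_pol t = f"
      by (simp add: a t_def tensor_to_pol_def lin_ext_sum)
    ultimately show ?thesis by blast
  qed
  ultimately show "tensor_to_pol ` tensor_square n = (TruncPol n :: 'k laurent set)"
    by blast
qed

lemma op_algebra_diff:
  assumes "A \<in> op_algebra S" "B \<in> op_algebra S"
  shows "(\<lambda>f. A f - B f) \<in> op_algebra S"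
  using op_algebra.add[OF assms(1) op_algebra.scale[OF assms(2), of "-1"]]
  by simp

lemma cg_operator_in_diff_dunkl: "cg_operator n \<kappa> c0 c1 \<in> diff_dunkl \<kappa> c0 c1"
proof -
  have gens: "{sigma, xi1, xi2, mul1, mul2, dunkl1 \<kappa> c0 c1, dunkl2 \<kappa> c0 c1,
      mulinv1, mulinv2, partial1, partial2} \<subseteq> diff_dunkl \<kappa> c0 c1"
    by (auto simp: diff_dunkl_def cherednik_def intro: op_algebra.gen)
  have comp: "(\<lambda>f. G (A f)) \<in> diff_dunkl \<kappa> c0 c1"
    if "G \<in> {sigma, xi1, xi2, mul1, mul2, dunkl1 \<kappa> c0 c1, dunkl2 \<kappa> c0 c1,
      mulinv1, mulinv2, partial1, partial2}" "A \<in> diff_dunkl \<kappa> c0 c1" for G A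
  proof -
    have "G \<in> diff_dunkl \<kappa> c0 c1"
      using that(1) gens by blast
    then show ?thesis
      using that(2) unfolding diff_dunkl_def by (rule op_algebra.mult)
  qed
  note rules = op_algebra.add op_algebra_diff op_algebra.scale op_algebra.one
  show ?thesis
    unfolding cg_operator_def[abs_def] g1_def g2_def g3_def g4_def
    by (intro rules[where S = "cherednik \<kappa> c0 c1 \<union> {mulinv1, mulinv2, partial1, partial2}",
            folded diff_dunkl_def]
          comp[of sigma] comp[of xi1] comp[of xi2] comp[of mul1] comp[of mul2]
          comp[of "dunkl1 \<kappa> c0 c1"] comp[of "dunkl2 \<kappa> c0 c1"]
          comp[of mulinv1] comp[of mulinv2] comp[of partial1] comp[of partial2]) simp_all
qed

section \<open>The r-matrix as a differential-Dunkl operator\<close>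

theorem theorem3p4:
  fixes n :: nat and \<kappa> c0 c1 :: "'k::{alg_closed_field, field_char_0}"
  assumes "n \<ge> 3" and "odd n" and "c0 \<noteq> 0"
  shows "cg_operator n \<kappa> c0 c1 \<in> diff_dunkl \<kappa> c0 c1
    \<and> bij_betw tensor_to_pol (tensor_square n :: (nat \<times> nat \<Rightarrow>\<^sub>0 'k) set) (TruncPol n)
    \<and> (\<forall>t \<in> tensor_square n.
          tensor_to_pol (tensor_act (cremmer_gervais (n - 2) n) t)
            = cg_operator n \<kappa> c0 c1 (tensor_to_pol t))"
proof (intro conjI ballI)
  show "cg_operator n \<kappa> c0 c1 \<in> diff_dunkl \<kappa> c0 c1"
    by (rule cg_operator_in_diff_dunkl)
  show "bij_betw tensor_to_pol (tensor_square n :: (nat \<times> nat \<Rightarrow>\<^sub>0 'k) set) (TruncPol n)"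
    by (rule tensor_to_pol_bij)
next
  fix t :: "nat \<times> nat \<Rightarrow>\<^sub>0 'k"
  assume t: "t \<in> tensor_square n"
  show "tensor_to_pol (tensor_act (cremmer_gervais (n - 2) n) t) = cg_operator n \<kappa> c0 c1 (tensor_to_pol t)"
  proof (rule linear_map_eqI[where F = "\<lambda>t. tensor_to_pol (tensor_act (cremmer_gervais (n - 2) n) t)"
        and G = "\<lambda>t. cg_operator n \<kappa> c0 c1 (tensor_to_pol t)"])
    show "linear_map (\<lambda>t :: nat \<times> nat \<Rightarrow>\<^sub>0 'k. tensor_to_pol (tensor_act (cremmer_gervais (n - 2) n) t))"
      by (rule linear_map_comp[OF linear_map_tensor_to_pol linear_map_tensor_act])
    show "linear_map (\<lambda>t. cg_operator n \<kappa> c0 c1 (tensor_to_pol t))"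
      by (rule linear_map_comp[OF linear_map_cg_operator[OF assms(3)] linear_map_tensor_to_pol])
    fix p assume "p \<in> Poly_Mapping.keys t"
    then obtain i j where p: "p = (i, j)" "i \<in> {1..n}" "j \<in> {1..n}"
      using t by (auto simp: tensor_square_def)
    have "tensor_to_pol (Poly_Mapping.single (i, j) 1) = (mon (int i - 1) (int j - 1) :: 'k laurent)"
      by (simp add: tensor_to_pol_def)
    then show "tensor_to_pol (tensor_act (cremmer_gervais (n - 2) n) (Poly_Mapping.single p 1))
        = cg_operator n \<kappa> c0 c1 (tensor_to_pol (Poly_Mapping.single p 1))"
      by (simp only: p(1) cremmer_gervais_mon[OF assms(1,2) p(2,3)] cg_operator_mon[OF assms(3)])
  qed
qed

end
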